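(* Suppose that $\tilde{\mathfrak g}=\mathfrak{pe}(n)$ and $\ell\ge1$. Let $\mathfrak B^0,\dots,\mathfrak B^q$ be the chain of Borel subalgebras and $\gamma_0,\dots,\gamma_{q-1}$ the sequence of odd roots described in the context. Let $L\in\tilde{\mathcal O}_\ell$ be a simple $\tilde{\mathfrak g}_\ell$-module with $\mathfrak B^p_\ell$-highest weight vector $v_\lambda\in L$ of $\mathfrak B^p_\ell$-highest weight $\lambda=(\lambda^{(0)},\dots,\lambda^{(\ell)})\in\mathfrak h_\ell^*$, for some $0\le p<q$. Then: (i) Suppose that $\gamma_p=\epsilon_i+\epsilon_j$ for some $i<j$; put $\overline{\gamma_p}=\epsilon_i-\epsilon_j$ and let $f$ be a non-zero root vector in $\tilde{\mathfrak g}^{\gamma_p}$. If $\langle\lambda^{(k)},\overline{\gamma_p}\rangle\neq0$ and $\langle\lambda^{(k+1)},\overline{\gamma_p}\rangle=\cdots=\langle\lambda^{(\ell)},\overline{\gamma_p}\rangle=0$ for some $0\le k\le\ell$, then $f^{(0)}f^{(1)}\cdots f^{(k)}v_\lambda$ is a $\mathfrak B^{p+1}_\ell$-highest weight vector of $L$. Otherwise, if $\langle\lambda^{(k)},\overline{\gamma_p}\rangle=0$ for all $0\le k\le\ell$, then $v_\lambda$ is a $\mathfrak B^{p+1}_\ell$-highest weight vector of $L$. (ii) Suppose that $\mathfrak B^p$ and $\mathfrak B^{p+1}$ are connected by an inclusion. Then $v_\lambda$ is a $\mathfrak B^{p+1}_\ell$-highest weight vector of $L$.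
   Context: Everything is over $\mathbb C$. $\mathfrak{pe}(n)$ is the periplectic Lie superalgebra of matrices $\begin{pmatrix}A&B\\C&-A^t\end{pmatrix}\in\mathfrak{gl}(n|n)$ with $B^t=B$, $C^t=-C$; its even part is $\mathfrak g\cong\mathfrak{gl}(n)$, $\tilde{\mathfrak g}^1$ is the $B$-part and $\tilde{\mathfrak g}^{-1}$ the $C$-part. $\mathfrak h$ is the diagonal Cartan subalgebra, $\epsilon_i\in\mathfrak h^*$ dual to $E_{ii}-E_{n+i,n+i}$, $\langle\epsilon_i,\epsilon_j\rangle=\delta_{ij}$. Even roots: $\epsilon_i-\epsilon_j$ ($i\ne j$), positive for $i<j$; odd roots: $\epsilon_i+\epsilon_j$ ($i\le j$, roots of $\tilde{\mathfrak g}^1$) and $-\epsilon_i-\epsilon_j$ ($i<j$, roots of $\tilde{\mathfrak g}^{-1}$). Let $\mathfrak b=\tilde{\mathfrak b}_{\bar0}$ be the Borel subalgebra of $\mathfrak g$ for the positive even roots, $\tilde{\mathfrak b}=\mathfrak b\oplus\tilde{\mathfrak g}^1$ (distinguished), $\tilde{\mathfrak b}^r=\mathfrak b\oplus\tilde{\mathfrak g}^{-1}$ (reverse). Two Borel subalgebras with the same even part are connected by an inclusion if one is a codimension-one subalgebra of the other, and connected by an odd reflection associated with an odd root $\gamma$ if their intersection has codimension one in both and $c\gamma$ is a root of the first and $-c\gamma$ a root of the second for some $c=\pm1$. There is a chain $\mathfrak B^0=\tilde{\mathfrak b}^r,\mathfrak B^1,\dots,\mathfrak B^q=\tilde{\mathfrak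 b}$ of Borel subalgebras with even part $\mathfrak b$, consecutive ones connected by an odd reflection or an inclusion, with the sequence of odd roots $$(\gamma_0,\dots,\gamma_{q-1})=(2\epsilon_1,\ \epsilon_1+\epsilon_2,\ 2\epsilon_2,\ \epsilon_1+\epsilon_3,\ \epsilon_2+\epsilon_3,\ 2\epsilon_3,\ \dots,\ \epsilon_{n-1}+\epsilon_n,\ 2\epsilon_n)$$ such that $\gamma_p$ is a root of $\mathfrak B^{p+1}$ but not of $\mathfrak B^p$. (Thus the odd roots of $\mathfrak B^p$ are $\gamma_0,\dots,\gamma_{p-1}$ together with $-\gamma_r$ for those $r\ge p$ with $\gamma_r=\epsilon_i+\epsilon_j$, $i<j$; $\mathfrak B^p$ and $\mathfrak B^{p+1}$ are connected by an odd reflection exactly when $\gamma_p=\epsilon_i+\epsilon_j$ with $i<j$.) $\tilde{\mathfrak g}_\ell=\tilde{\mathfrak g}\otimes\mathbb C[\theta]/(\theta^{\ell+1})$, $\theta$ even, $[x\otimes\theta^i,y\otimes\theta^j]=[x,y]\otimes\theta^{i+j}$; $x^{(i)}=x\otimes\theta^i$; $\mathfrak s_\ell=\mathfrak s\otimes\mathbb C[\theta]/(\theta^{\ell+1})$. $\tilde{\mathcal O}_\ell$ is the category of finitely generated $\tilde{\mathfrak g}_\ell$-modules on which $\mathfrak h$ acts semisimply and $\tilde{\mathfrak b}_\ell$ acts locally finitely. A $\mathfrak B^p_\ell$-highest weight vector of weight $\lambda\in\mathfrak h_\ell^*$ is a non-zero vector killed by $x\otimes\theta^i$ for all root vectors $x\in\mathfrak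 B^p$ and all $i$, on which $\mathfrak h_\ell$ acts by $\lambda$. $\lambda^{(i)}(h)=\lambda(h\otimes\theta^i)$. *)

theory Defs
  imports "Jordan_Normal_Form.Matrix" Complex_Main
begin

text \<open>Indices run over 0, ..., n-1. Parities are booleans, with True standing for odd.\<close>

definition pe :: "nat \<Rightarrow> complex mat set" where
  "pe n = {four_block_mat A B C (- transpose_mat A) | A B C.
     A \<in> carrier_mat n n \<and> B \<in> carrier_mat n n \<and> C \<in> carrier_mat n n \<and>
     transpose_mat B = B \<and> transpose_mat C = - C}"

definition parity_part :: "nat \<Rightarrow> bool \<Rightarrow> complex mat \<Rightarrow> complex mat" where
  "parity_part n d X =
     mat (n + n) (n + n) (\<lambda>(a, b). if ((a < n) \<noteq> (b < n)) = d then X $$ (a, b) else 0)"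

definition pe_part :: "nat \<Rightarrow> bool \<Rightarrow> complex mat set" where
  "pe_part n d = {X \<in> pe n. parity_part n d X = X}"

definition sbracket :: "nat \<Rightarrow> complex mat \<Rightarrow> complex mat \<Rightarrow> complex mat" where
  "sbracket n X Y =
     (let X0 = parity_part n False X; X1 = parity_part n True X;
          Y0 = parity_part n False Y; Y1 = parity_part n True Y
      in (X0 * Y0 - Y0 * X0) + (X0 * Y1 - Y1 * X0) + (X1 * Y0 - Y0 * X1) + (X1 * Y1 + Y1 * X1))"

definition cartan :: "nat \<Rightarrow> complex mat set" where
  "cartan n = {four_block_mat D (0\<^sub>m n n) (0\<^sub>m n n) (- D) | D.
     D \<in> carrier_mat n n \<and> diagonal_mat D}"

text \<open>Matrices of varying size do not form an additive group type, so linear spans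
  of (n+n)-square matrices are generated inductively.\<close>

inductive_set mat_span :: "nat \<Rightarrow> complex mat set \<Rightarrow> complex mat set"
  for n :: nat and S :: "complex mat set" where
  zero: "0\<^sub>m (n + n) (n + n) \<in> mat_span n S"
| gen: "X \<in> S \<Longrightarrow> X \<in> mat_span n S"
| add: "X \<in> mat_span n S \<Longrightarrow> Y \<in> mat_span n S \<Longrightarrow> X + Y \<in> mat_span n S"
| smult: "X \<in> mat_span n S \<Longrightarrow> c \<cdot>\<^sub>m X \<in> mat_span n S"

text \<open>Elements of the dual of the Cartan subalgebra are represented by functions on
  matrices; only their values on \<open>cartan n\<close> matter.\<close>

type_synonym weight = "complex mat \<Rightarrow> complex"

definition eps :: "nat \<Rightarrow> weight" where
  "eps i = (\<lambda>h. h $$ (i, i))"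

definition wt_add :: "weight \<Rightarrow> weight \<Rightarrow> weight" where
  "wt_add \<mu> \<nu> = (\<lambda>h. \<mu> h + \<nu> h)"

definition wt_neg :: "weight \<Rightarrow> weight" where
  "wt_neg \<mu> = (\<lambda>h. - \<mu> h)"

definition wt_diff :: "weight \<Rightarrow> weight \<Rightarrow> weight" where
  "wt_diff \<mu> \<nu> = (\<lambda>h. \<mu> h - \<nu> h)"

text \<open>The basis of the Cartan subalgebra dual to the \<open>eps i\<close>; \<open>wt_form\<close> is the bilinear
  form for which the \<open>eps i\<close> are orthonormal.\<close>

definition cartan_basis :: "nat \<Rightarrow> nat \<Rightarrow> complex mat" where
  "cartan_basis n i = mat (n + n) (n + n)
     (\<lambda>(a, b). if a = i \<and> b = i then 1 else if a = n + i \<and> b = n + i then - 1 else 0)"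

definition wt_form :: "nat \<Rightarrow> weight \<Rightarrow> weight \<Rightarrow> complex" where
  "wt_form n \<mu> \<nu> = (\<Sum>a<n. \<mu> (cartan_basis n a) * \<nu> (cartan_basis n a))"

definition even_roots :: "nat \<Rightarrow> weight set" where
  "even_roots n = {wt_diff (eps i) (eps j) | i j. i < n \<and> j < n \<and> i \<noteq> j}"

definition pos_even_roots :: "nat \<Rightarrow> weight set" where
  "pos_even_roots n = {wt_diff (eps i) (eps j) | i j. i < j \<and> j < n}"

definition odd_roots_plus :: "nat \<Rightarrow> weight set" where
  "odd_roots_plus n = {wt_add (eps i) (eps j) | i j. i \<le> j \<and> j < n}"

definition odd_roots_minus :: "nat \<Rightarrow> weight set" where
  "odd_roots_minus n = {wt_neg (wt_add (eps i) (eps j)) | i j. i < j \<and> j < n}"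

definition roots :: "nat \<Rightarrow> weight set" where
  "roots n = even_roots n \<union> odd_roots_plus n \<union> odd_roots_minus n"

definition root_space :: "nat \<Rightarrow> weight \<Rightarrow> complex mat set" where
  "root_space n \<alpha> = {x \<in> pe n. \<forall>h\<in>cartan n. sbracket n h x = \<alpha> h \<cdot>\<^sub>m x}"

definition borel_of :: "nat \<Rightarrow> weight set \<Rightarrow> complex mat set" where
  "borel_of n R = mat_span n (cartan n \<union> (\<Union>\<alpha> \<in> pos_even_roots n \<union> R. root_space n \<alpha>))"

definition distinguished_borel :: "nat \<Rightarrow> complex mat set" where
  "distinguished_borel n = borel_of n (odd_roots_plus n)"

definition reverse_borel :: "nat \<Rightarrow> complex mat set" where
  "reverse_borel n = borel_of n (odd_roots_minus n)"

definition gamma_seq :: "nat \<Rightarrow> weight list" where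
  "gamma_seq n = concat (map (\<lambda>j. map (\<lambda>i. wt_add (eps i) (eps j)) [0..<Suc j]) [0..<n])"

definition chain_odd_roots :: "nat \<Rightarrow> nat \<Rightarrow> weight set" where
  "chain_odd_roots n p =
     {gamma_seq n ! r | r. r < p \<and> r < length (gamma_seq n)} \<union>
     {wt_neg (gamma_seq n ! r) | r. p \<le> r \<and> r < length (gamma_seq n) \<and>
        (\<exists>i j. i < j \<and> j < n \<and> gamma_seq n ! r = wt_add (eps i) (eps j))}"

definition chain_borel :: "nat \<Rightarrow> nat \<Rightarrow> complex mat set" where
  "chain_borel n p = borel_of n (chain_odd_roots n p)"

lemma set_gamma_seq: "set (gamma_seq n) = odd_roots_plus n"
proof (rule Set.set_eqI)
  fix g
  have "g \<in> set (gamma_seq n) \<longleftrightarrow> (\<exists>j<n. \<exists>i<Suc j. g = wt_add (eps i) (eps j))"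
    unfolding gamma_seq_def set_concat set_map set_upt image_image UN_iff image_iff Bex_def
    by (simp only: atLeastLessThan_iff le0 simp_thms ex_simps)
  also have "\<dots> \<longleftrightarrow> g \<in> odd_roots_plus n"
    unfolding odd_roots_plus_def less_Suc_eq_le by blast
  finally show "g \<in> set (gamma_seq n) \<longleftrightarrow> g \<in> odd_roots_plus n" .
qed

lemma chain_borel_first: "chain_borel n 0 = reverse_borel n"
proof -
  have "wt_add (eps i) (eps j) \<in> set (gamma_seq n)" if "i < j" "j < n" for i j
    using that by (auto simp: set_gamma_seq odd_roots_plus_def intro: less_imp_le)
  then have ex: "\<exists>r<length (gamma_seq n). gamma_seq n ! r = wt_add (eps i) (eps j)"
    if "i < j" "j < n" for i j
    using that by (metis in_set_conv_nth)
  have "chain_odd_roots n 0 = odd_roots_minus n"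
  proof (rule Set.set_eqI, rule iffI)
    fix g assume "g \<in> chain_odd_roots n 0"
    then show "g \<in> odd_roots_minus n"
      unfolding chain_odd_roots_def odd_roots_minus_def by fastforce
  next
    fix g assume "g \<in> odd_roots_minus n"
    then obtain i j where ij: "i < j" "j < n" and g: "g = wt_neg (wt_add (eps i) (eps j))"
      unfolding odd_roots_minus_def by blast
    from ex[OF ij] obtain r where "r < length (gamma_seq n)"
      "gamma_seq n ! r = wt_add (eps i) (eps j)" by blast
    with ij g show "g \<in> chain_odd_roots n 0"
      unfolding chain_odd_roots_def by (metis (mono_tags, lifting) UnCI le0 mem_Collect_eq)
  qed
  then show ?thesis
    by (simp add: chain_borel_def reverse_borel_def)
qed

lemma chain_borel_last: "chain_borel n (length (gamma_seq n)) = distinguished_borel n"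
proof -
  have "chain_odd_roots n (length (gamma_seq n)) = set (gamma_seq n)"
    by (auto simp: chain_odd_roots_def set_conv_nth)
  then show ?thesis
    by (simp add: chain_borel_def distinguished_borel_def set_gamma_seq)
qed

definition codim_one_subalgebra :: "nat \<Rightarrow> complex mat set \<Rightarrow> complex mat set \<Rightarrow> bool" where
  "codim_one_subalgebra n S T \<longleftrightarrow>
     mat_span n S = S \<and> (\<forall>x\<in>S. \<forall>y\<in>S. sbracket n x y \<in> S) \<and>
     S \<subseteq> T \<and> (\<exists>x\<in>T. x \<notin> S \<and> T = mat_span n (insert x S))"

definition connected_by_inclusion :: "nat \<Rightarrow> complex mat set \<Rightarrow> complex mat set \<Rightarrow> bool" where
  "connected_by_inclusion n S T \<longleftrightarrow> codim_one_subalgebra n S T \<or> codim_one_subalgebra n T S"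

text \<open>An element \<open>\<Sum>i\<le>l. x i \<otimes> \<theta>^i\<close> is represented by its coefficient sequence \<open>x\<close>,
  which is zero beyond \<open>l\<close>.\<close>

type_synonym tmat = "nat \<Rightarrow> complex mat"

definition takiff :: "nat \<Rightarrow> nat \<Rightarrow> complex mat set \<Rightarrow> tmat set" where
  "takiff n l S = {x. (\<forall>i\<le>l. x i \<in> S) \<and> (\<forall>i>l. x i = 0\<^sub>m (n + n) (n + n))}"

definition tens :: "nat \<Rightarrow> complex mat \<Rightarrow> nat \<Rightarrow> tmat" where
  "tens n x i = (\<lambda>k. if k = i then x else 0\<^sub>m (n + n) (n + n))"

definition tadd :: "tmat \<Rightarrow> tmat \<Rightarrow> tmat" where
  "tadd x y = (\<lambda>k. x k + y k)"

definition tsmult :: "complex \<Rightarrow> tmat \<Rightarrow> tmat" where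
  "tsmult c x = (\<lambda>k. c \<cdot>\<^sub>m x k)"

definition tbracket :: "nat \<Rightarrow> nat \<Rightarrow> tmat \<Rightarrow> tmat \<Rightarrow> tmat" where
  "tbracket n l x y = (\<lambda>k. if k \<le> l
     then mat (n + n) (n + n) (\<lambda>(a, b). \<Sum>i\<le>k. sbracket n (x i) (y (k - i)) $$ (a, b))
     else 0\<^sub>m (n + n) (n + n))"

text \<open>Supermodules: \<open>V False\<close> and \<open>V True\<close> are the even and odd part of the underlying
  vector space, which is the whole type \<open>'v\<close>.\<close>

locale takiff_pe_module = vector_space scale
  for scale :: "complex \<Rightarrow> 'v::ab_group_add \<Rightarrow> 'v" +
  fixes n l :: nat
    and V :: "bool \<Rightarrow> 'v set"
    and act :: "tmat \<Rightarrow> 'v \<Rightarrow> 'v"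
  assumes grading_subspace: "subspace (V d)"
    and grading_disjoint: "V False \<inter> V True = {0}"
    and grading_sum: "\<exists>v0\<in>V False. \<exists>v1\<in>V True. v = v0 + v1"
    and act_add: "x \<in> takiff n l (pe n) \<Longrightarrow> act x (v + w) = act x v + act x w"
    and act_scale: "x \<in> takiff n l (pe n) \<Longrightarrow> act x (scale c v) = scale c (act x v)"
    and act_tadd: "x \<in> takiff n l (pe n) \<Longrightarrow> y \<in> takiff n l (pe n) \<Longrightarrow>
          act (tadd x y) v = act x v + act y v"
    and act_tsmult: "x \<in> takiff n l (pe n) \<Longrightarrow> act (tsmult c x) v = scale c (act x v)"
    and act_parity: "x \<in> takiff n l (pe_part n d) \<Longrightarrow> v \<in> V e \<Longrightarrow> act x v \<in> V (d \<noteq> e)"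
    and act_bracket: "x \<in> takiff n l (pe_part n d) \<Longrightarrow> y \<in> takiff n l (pe_part n e) \<Longrightarrow>
          act (tbracket n l x y) v =
            act x (act y v) - scale (if d \<and> e then - 1 else 1) (act y (act x v))"

definition submodule ::
  "(complex \<Rightarrow> 'v::ab_group_add \<Rightarrow> 'v) \<Rightarrow> nat \<Rightarrow> nat \<Rightarrow> (tmat \<Rightarrow> 'v \<Rightarrow> 'v) \<Rightarrow> 'v set \<Rightarrow> bool" where
  "submodule scale n l act W \<longleftrightarrow>
     module.subspace scale W \<and> (\<forall>x\<in>takiff n l (pe n). \<forall>w\<in>W. act x w \<in> W)"

definition graded_subset :: "(bool \<Rightarrow> 'v::ab_group_add set) \<Rightarrow> 'v set \<Rightarrow> bool" where
  "graded_subset V W \<longleftrightarrow> (\<forall>w\<in>W. \<exists>w0\<in>W \<inter> V False. \<exists>w1\<in>W \<inter> V True. w = w0 + w1)"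

definition simple_module ::
  "(complex \<Rightarrow> 'v::ab_group_add \<Rightarrow> 'v) \<Rightarrow> nat \<Rightarrow> nat \<Rightarrow> (bool \<Rightarrow> 'v set) \<Rightarrow>
   (tmat \<Rightarrow> 'v \<Rightarrow> 'v) \<Rightarrow> bool" where
  "simple_module scale n l V act \<longleftrightarrow>
     (\<exists>v::'v. v \<noteq> 0) \<and>
     (\<forall>W. submodule scale n l act W \<and> graded_subset V W \<longrightarrow> W = {0} \<or> W = UNIV)"

definition weight_space ::
  "(complex \<Rightarrow> 'v::ab_group_add \<Rightarrow> 'v) \<Rightarrow> nat \<Rightarrow> (tmat \<Rightarrow> 'v \<Rightarrow> 'v) \<Rightarrow> weight \<Rightarrow> 'v set" where
  "weight_space scale n act \<mu> = {v. \<forall>h\<in>cartan n. act (tens n h 0) v = scale (\<mu> h) v}"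

definition in_category_O ::
  "(complex \<Rightarrow> 'v::ab_group_add \<Rightarrow> 'v) \<Rightarrow> nat \<Rightarrow> nat \<Rightarrow> (tmat \<Rightarrow> 'v \<Rightarrow> 'v) \<Rightarrow> bool" where
  "in_category_O scale n l act \<longleftrightarrow>
     (\<exists>S. finite S \<and> (\<forall>W. submodule scale n l act W \<and> S \<subseteq> W \<longrightarrow> W = UNIV)) \<and>
     module.span scale (\<Union>\<mu>. weight_space scale n act \<mu>) = UNIV \<and>
     (\<forall>v. \<exists>S. finite S \<and> v \<in> module.span scale S \<and>
        (\<forall>x\<in>takiff n l (distinguished_borel n). \<forall>w\<in>module.span scale S.
           act x w \<in> module.span scale S))"

definition takiff_dual :: "nat \<Rightarrow> nat \<Rightarrow> (tmat \<Rightarrow> complex) set" where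
  "takiff_dual n l = {lam.
     (\<forall>x\<in>takiff n l (cartan n). \<forall>y\<in>takiff n l (cartan n). lam (tadd x y) = lam x + lam y) \<and>
     (\<forall>c. \<forall>x\<in>takiff n l (cartan n). lam (tsmult c x) = c * lam x)}"

definition wt_component :: "nat \<Rightarrow> (tmat \<Rightarrow> complex) \<Rightarrow> nat \<Rightarrow> weight" where
  "wt_component n lam k = (\<lambda>h. lam (tens n h k))"

definition highest_weight_vector ::
  "(complex \<Rightarrow> 'v::ab_group_add \<Rightarrow> 'v) \<Rightarrow> nat \<Rightarrow> nat \<Rightarrow> (tmat \<Rightarrow> 'v \<Rightarrow> 'v) \<Rightarrow>
   complex mat set \<Rightarrow> (tmat \<Rightarrow> complex) \<Rightarrow> 'v \<Rightarrow> bool" where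
  "highest_weight_vector scale n l act B lam v \<longleftrightarrow>
     lam \<in> takiff_dual n l \<and> v \<noteq> 0 \<and>
     (\<forall>\<alpha>\<in>roots n. \<forall>x\<in>root_space n \<alpha> \<inter> B. \<forall>i\<le>l. act (tens n x i) v = 0) \<and>
     (\<forall>h\<in>takiff n l (cartan n). act h v = scale (lam h) v)"

end

theory Submission
  imports Defs
begin

text \<open>
  Write \<open>\<gamma> = \<epsilon>\<^sub>i + \<epsilon>\<^sub>j\<close> for the odd root added in the given step of the chain, \<open>f\<close> for a root vector of
  \<open>\<gamma>\<close> and, when \<open>i < j\<close>, \<open>e\<close> for one of \<open>-\<gamma>\<close>. Write \<open>R\<close> for the roots of the old Borel subalgebra and
  \<open>R'\<close> for \<open>R - {-\<gamma>}\<close>. Everything rests on two facts about roots.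

  First, bracketing with \<open>f\<close> maps root vectors with root in \<open>R'\<close> to zero or to root vectors with root
  in \<open>R'\<close> (\<open>borel_roots_bracket_gamma\<close>). Therefore the operators of \<open>f\<close> preserve the space of vectors
  killed by \<open>R'\<close>. Second, some linear functional on the weights is at most zero on all roots
  outside \<open>R\<close> and strictly negative on \<open>\<gamma>\<close> (\<open>separating_functional\<close>). A nonzero vector killed by \<open>R\<close> on
  which the Cartan part acts by scalars generates a simple module through the roots outside \<open>R\<close> alone,
  so no weight of the module exceeds the weight of that vector for the functional
  (\<open>no_higher_weight\<close>).

  Let \<open>v\<close> be a highest weight vector. Suppose that \<open>f\<^sup>(\<^sup>m\<^sup>) v\<close> is killed by \<open>R\<close> and that \<open>f\<close> kills \<open>v\<close> in all degrees
  above \<open>m\<close>, which makes \<open>f\<^sup>(\<^sup>m\<^sup>) v\<close> a common eigenvector of the Cartan part. If it were nonzero,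
  then \<open>v\<close> would have a weight above it, because \<open>\<gamma>\<close> is negative for the functional. Thus \<open>f\<^sup>(\<^sup>m\<^sup>) v = 0\<close>.
  The only obstruction to being killed by \<open>R\<close> is \<open>-\<gamma>\<close>, and there
  \<open>e\<^sup>(\<^sup>a\<^sup>) f\<^sup>(\<^sup>m\<^sup>) v = [e,f]\<^sup>(\<^sup>a\<^sup>+\<^sup>m\<^sup>) v\<close>, where \<open>[e,f]\<close> is a multiple of the Cartan element dual to
  \<open>\<epsilon>\<^sub>i - \<epsilon>\<^sub>j\<close>. So \<open>f\<^sup>(\<^sup>m\<^sup>) v = 0\<close> whenever \<open>\<lambda>\<^sup>(\<^sup>r\<^sup>)\<close> pairs to zero with \<open>\<epsilon>\<^sub>i - \<epsilon>\<^sub>j\<close> for all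
  \<open>r \<ge> m\<close> (\<open>raising_vanishes\<close>). If \<open>-\<gamma>\<close> is no root, which is the case of an inclusion, then
  there is no obstruction at all. This settles the claims in which \<open>v\<close> itself is again a highest weight
  vector.

  In the remaining case let \<open>k\<close> be the last index at which the pairing \<open>c\<^sub>k\<close> is nonzero. All
  \<open>f\<^sup>(\<^sup>m\<^sup>)\<close> anticommute and square to zero, and those with \<open>m > k\<close> kill \<open>v\<close>; hence all of them
  kill \<open>w = f\<^sup>(\<^sup>0\<^sup>) \<dots> f\<^sup>(\<^sup>k\<^sup>) v\<close>. It is nonzero because \<open>e\<^sup>(\<^sup>0\<^sup>) \<dots> e\<^sup>(\<^sup>k\<^sup>) w\<close> is a nonzero
  multiple of \<open>c\<^sub>k\<close> to the power \<open>k + 1\<close> times \<open>v\<close>: in each step only one bracket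
  contributes, the others being pairings above index \<open>k\<close> (\<open>odd_reflection\<close>).
\<close>

section \<open>The periplectic bracket in matrix entries\<close>

text \<open>Exchanging the two halves of the index range combines the three block conditions that define \<open>pe n\<close>
  into one symmetry \<open>(r, s) \<mapsto> (swap_half n s, swap_half n r)\<close> of the entries, up to the sign \<open>transpose_sign\<close>.\<close>

definition swap_half :: "nat \<Rightarrow> nat \<Rightarrow> nat" where
  "swap_half n r = (if r < n then r + n else r - n)"

definition transpose_sign :: "nat \<Rightarrow> nat \<Rightarrow> nat \<Rightarrow> complex" where
  "transpose_sign n r s = (if r < n \<and> \<not> s < n then 1 else - 1)"

text \<open>The sign in the super commutator of the matrix units at \<open>(r, t)\<close> and \<open>(t, s)\<close>.\<close>

definition koszul_sign :: "nat \<Rightarrow> nat \<Rightarrow> nat \<Rightarrow> nat \<Rightarrow> complex" where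
  "koszul_sign n r t s = (if (r < n) \<noteq> (t < n) \<and> (t < n) \<noteq> (s < n) then - 1 else 1)"

lemma swap_half_less: "r < n + n \<Longrightarrow> swap_half n r < n + n"
  by (auto simp: swap_half_def)

lemma swap_half_swap_half: "r < n + n \<Longrightarrow> swap_half n (swap_half n r) = r"
  by (auto simp: swap_half_def)

lemma swap_half_less_iff: "r < n + n \<Longrightarrow> swap_half n r < n \<longleftrightarrow> \<not> r < n"
  by (auto simp: swap_half_def)

lemma parity_part_carrier [simp]: "parity_part n d X \<in> carrier_mat (n + n) (n + n)"
  by (simp add: parity_part_def)

lemma parity_part_dim [simp]:
  "dim_row (parity_part n d X) = n + n" "dim_col (parity_part n d X) = n + n"
  by (simp_all add: parity_part_def)

lemma parity_part_index:
  "r < n + n \<Longrightarrow> s < n + n \<Longrightarrow>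
    parity_part n d X $$ (r, s) = (if ((r < n) \<noteq> (s < n)) = d then X $$ (r, s) else 0)"
  by (simp add: parity_part_def)

lemma sbracket_dim [simp]:
  "dim_row (sbracket n X Y) = n + n" "dim_col (sbracket n X Y) = n + n"
  by (simp_all add: sbracket_def Let_def)

lemma sbracket_carrier [simp]: "sbracket n X Y \<in> carrier_mat (n + n) (n + n)"
  by (rule carrier_matI) simp_all

lemma index_mult_sum:
  assumes "A \<in> carrier_mat N N" "B \<in> carrier_mat N N" "r < N" "s < N"
  shows "(A * B) $$ (r, s) = (\<Sum>t<N. A $$ (r, t) * B $$ (t, s))"
  using assms by (auto simp: scalar_prod_def atLeast0LessThan intro!: sum.cong)

text \<open>Grouping the products of the homogeneous parts by the intermediate index shows that each entry
  is a single sum in which only the Koszul sign depends on the parities. All later bracket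
  computations go through this formula.\<close>

lemma sbracket_index:
  assumes "r < n + n" "s < n + n"
  shows "sbracket n X Y $$ (r, s) =
    (\<Sum>t<n+n. X $$ (r, t) * Y $$ (t, s) - koszul_sign n r t s * (Y $$ (r, t) * X $$ (t, s)))"
proof -
  let ?X = "\<lambda>d. parity_part n d X" and ?Y = "\<lambda>d. parity_part n d Y"
  have prod: "(parity_part n d P * parity_part n e Q) $$ (r, s) =
      (\<Sum>t<n+n. parity_part n d P $$ (r, t) * parity_part n e Q $$ (t, s))" for d e P Q
    by (rule index_mult_sum) (use assms in simp_all)
  have "sbracket n X Y $$ (r, s) =
      ((?X False * ?Y False) $$ (r, s) - (?Y False * ?X False) $$ (r, s)) +
      ((?X False * ?Y True) $$ (r, s) - (?Y True * ?X False) $$ (r, s)) +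
      ((?X True * ?Y False) $$ (r, s) - (?Y False * ?X True) $$ (r, s)) +
      ((?X True * ?Y True) $$ (r, s) + (?Y True * ?X True) $$ (r, s))"
    using assms by (simp add: sbracket_def Let_def del: index_mult_mat(1))
  also have "\<dots> = (\<Sum>t<n+n. X $$ (r, t) * Y $$ (t, s) - koszul_sign n r t s * (Y $$ (r, t) * X $$ (t, s)))"
    unfolding prod sum.distrib[symmetric] sum_subtractf[symmetric]
    by (rule sum.cong) (use assms in \<open>auto simp: parity_part_index koszul_sign_def\<close>)
  finally show ?thesis .
qed

lemma sbracket_entry_cases:
  assumes "sbracket n x y $$ (r, s) \<noteq> 0" "r < n + n" "s < n + n"
  obtains t where "t < n + n" "x $$ (r, t) \<noteq> 0" "y $$ (t, s) \<noteq> 0"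
  | t where "t < n + n" "y $$ (r, t) \<noteq> 0" "x $$ (t, s) \<noteq> 0"
proof -
  obtain t where t: "t < n + n"
    and "x $$ (r, t) * y $$ (t, s) - koszul_sign n r t s * (y $$ (r, t) * x $$ (t, s)) \<noteq> 0"
    using assms by (auto simp: sbracket_index elim: sum.not_neutral_contains_not_neutral)
  then have "x $$ (r, t) \<noteq> 0 \<and> y $$ (t, s) \<noteq> 0 \<or> y $$ (r, t) \<noteq> 0 \<and> x $$ (t, s) \<noteq> 0"
    by fastforce
  then show ?thesis using that t by blast
qed

lemma pe_carrier: "X \<in> pe n \<Longrightarrow> X \<in> carrier_mat (n + n) (n + n)"
  by (auto simp: pe_def)

lemma pe_iff:
  "X \<in> pe n \<longleftrightarrow> X \<in> carrier_mat (n + n) (n + n) \<and>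
     (\<forall>r<n+n. \<forall>s<n+n. X $$ (swap_half n s, swap_half n r) = transpose_sign n r s * X $$ (r, s))"
  (is "_ \<longleftrightarrow> ?R")
proof
  assume "X \<in> pe n"
  then obtain A B C where X: "X = four_block_mat A B C (- transpose_mat A)"
    and carr: "A \<in> carrier_mat n n" "B \<in> carrier_mat n n" "C \<in> carrier_mat n n"
    and B: "transpose_mat B = B" and C: "transpose_mat C = - C"
    by (auto simp: pe_def)
  have B': "B $$ (j, i) = B $$ (i, j)" if "i < n" "j < n" for i j
    using arg_cong[OF B, of "\<lambda>M. M $$ (i, j)"] that carr by simp
  have C': "C $$ (j, i) = - C $$ (i, j)" if "i < n" "j < n" for i j
    using arg_cong[OF C, of "\<lambda>M. M $$ (i, j)"] that carr by simp
  show ?R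
    unfolding X using carr
    by (auto simp: swap_half_def transpose_sign_def intro: B' C')
next
  assume R: ?R
  define A where "A = mat n n (\<lambda>(r, s). X $$ (r, s))"
  define B where "B = mat n n (\<lambda>(r, s). X $$ (r, s + n))"
  define C where "C = mat n n (\<lambda>(r, s). X $$ (r + n, s))"
  have R': "X $$ (swap_half n s, swap_half n r) = transpose_sign n r s * X $$ (r, s)"
    if "r < n + n" "s < n + n" for r s using R that by blast
  have "X = four_block_mat A B C (- transpose_mat A)"
  proof (rule eq_matI)
    fix r s assume "r < dim_row (four_block_mat A B C (- transpose_mat A))"
      "s < dim_col (four_block_mat A B C (- transpose_mat A))"
    then have rs: "r < n + n" "s < n + n" by (auto simp: A_def)
    then show "X $$ (r, s) = four_block_mat A B C (- transpose_mat A) $$ (r, s)"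
      using R'[OF rs] by (auto simp: A_def B_def C_def swap_half_def transpose_sign_def)
  qed (use R in \<open>auto simp: A_def\<close>)
  moreover have "transpose_mat B = B"
  proof (rule eq_matI)
    fix r s assume "r < dim_row B" "s < dim_col B"
    then have "r < n" "s < n" by (auto simp: B_def)
    then show "transpose_mat B $$ (r, s) = B $$ (r, s)"
      using R'[of r "s + n"] by (auto simp: B_def swap_half_def transpose_sign_def)
  qed (auto simp: B_def)
  moreover have "transpose_mat C = - C"
  proof (rule eq_matI)
    fix r s assume "r < dim_row (- C)" "s < dim_col (- C)"
    then have "r < n" "s < n" by (auto simp: C_def)
    then show "transpose_mat C $$ (r, s) = (- C) $$ (r, s)"
      using R'[of "r + n" s] by (auto simp: C_def swap_half_def transpose_sign_def)
  qed (auto simp: C_def)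
  ultimately show "X \<in> pe n"
    unfolding pe_def by (intro CollectI exI[of _ A] exI[of _ B] exI[of _ C]) (auto simp: A_def B_def C_def)
qed

lemma peI:
  assumes "X \<in> carrier_mat (n + n) (n + n)"
    and "\<And>r s. r < n + n \<Longrightarrow> s < n + n \<Longrightarrow>
      X $$ (swap_half n s, swap_half n r) = transpose_sign n r s * X $$ (r, s)"
  shows "X \<in> pe n"
  using assms by (simp add: pe_iff)

lemma pe_swap:
  "X \<in> pe n \<Longrightarrow> r < n + n \<Longrightarrow> s < n + n \<Longrightarrow>
     X $$ (swap_half n s, swap_half n r) = transpose_sign n r s * X $$ (r, s)"
  by (simp add: pe_iff)

lemma pe_zero: "0\<^sub>m (n + n) (n + n) \<in> pe n"
  by (rule peI) (simp_all add: swap_half_less)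

lemma pe_add:
  assumes "X \<in> pe n" "Y \<in> pe n" shows "X + Y \<in> pe n"
  by (rule peI) (use assms pe_carrier[OF assms(1)] pe_carrier[OF assms(2)]
      in \<open>auto simp: swap_half_less pe_swap algebra_simps\<close>)

lemma pe_smult:
  assumes "X \<in> pe n" shows "c \<cdot>\<^sub>m X \<in> pe n"
  by (rule peI) (use assms pe_carrier[OF assms] in \<open>auto simp: swap_half_less pe_swap\<close>)

text \<open>The symmetry that characterises \<open>pe n\<close> reverses the order of products, as a transpose does. The
  sign produced in this way is the negative Koszul sign, up to the transpose sign of the entry, so it exchanges the two products of the super
  commutator.\<close>

lemma pe_sbracket:
  assumes X: "X \<in> pe n" and Y: "Y \<in> pe n" shows "sbracket n X Y \<in> pe n"
proof (rule peI)
  fix r s assume rs: "r < n + n" "s < n + n"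
  let ?w = "swap_half n"
  have sign: "transpose_sign n t s * transpose_sign n r t = - koszul_sign n r t s * transpose_sign n r s"
    "koszul_sign n (?w s) (?w t) (?w r) = koszul_sign n r t s"
    "koszul_sign n r t s * koszul_sign n r t s = 1"
    if "t < n + n" for t
    using that rs by (auto simp: transpose_sign_def koszul_sign_def swap_half_less_iff)
  have bij: "bij_betw ?w {..<n+n} {..<n+n}"
    by (rule bij_betwI[of _ _ _ ?w]) (auto simp: swap_half_less swap_half_swap_half)
  have "sbracket n X Y $$ (?w s, ?w r) =
      (\<Sum>t<n+n. X $$ (?w s, ?w t) * Y $$ (?w t, ?w r)
        - koszul_sign n (?w s) (?w t) (?w r) * (Y $$ (?w s, ?w t) * X $$ (?w t, ?w r)))"
    using rs by (subst sum.reindex_bij_betw[OF bij]) (simp add: sbracket_index swap_half_less)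
  also have "\<dots> = (\<Sum>t<n+n. transpose_sign n r s *
      (X $$ (r, t) * Y $$ (t, s) - koszul_sign n r t s * (Y $$ (r, t) * X $$ (t, s))))"
  proof (rule sum.cong)
    fix t assume "t \<in> {..<n+n}"
    then have t: "t < n + n" by simp
    have "X $$ (?w s, ?w t) * Y $$ (?w t, ?w r) - koszul_sign n (?w s) (?w t) (?w r) * (Y $$ (?w s, ?w t) * X $$ (?w t, ?w r))
       = (transpose_sign n t s * transpose_sign n r t) * (X $$ (t, s) * Y $$ (r, t)
           - koszul_sign n r t s * (Y $$ (t, s) * X $$ (r, t)))"
      using rs t X Y by (simp add: pe_swap sign(2) ring_distribs mult_ac)
    also have "\<dots> = transpose_sign n r s * (koszul_sign n r t s * koszul_sign n r t s * (X $$ (r, t) * Y $$ (t, s))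
         - koszul_sign n r t s * (Y $$ (r, t) * X $$ (t, s)))"
      unfolding sign(1)[OF t] by (simp add: algebra_simps)
    finally show "X $$ (?w s, ?w t) * Y $$ (?w t, ?w r) - koszul_sign n (?w s) (?w t) (?w r) * (Y $$ (?w s, ?w t) * X $$ (?w t, ?w r))
       = transpose_sign n r s * (X $$ (r, t) * Y $$ (t, s) - koszul_sign n r t s * (Y $$ (r, t) * X $$ (t, s)))"
      by (simp add: sign(3)[OF t])
  qed simp
  finally show "sbracket n X Y $$ (?w s, ?w r) = transpose_sign n r s * sbracket n X Y $$ (r, s)"
    using rs by (simp add: sbracket_index sum_distrib_left)
qed simp

section \<open>Root spaces\<close>

lemma cartan_subset_pe: "h \<in> cartan n \<Longrightarrow> h \<in> pe n"
proof -
  assume "h \<in> cartan n"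
  then obtain D where D: "D \<in> carrier_mat n n" "diagonal_mat D"
    and h: "h = four_block_mat D (0\<^sub>m n n) (0\<^sub>m n n) (- D)"
    by (auto simp: cartan_def)
  have "transpose_mat D = D"
    by (rule eq_matI) (use D in \<open>auto simp: diagonal_mat_def, metis\<close>)
  then show "h \<in> pe n"
    unfolding pe_def using D h
    by (intro CollectI exI[of _ D] exI[of _ "0\<^sub>m n n"]) (auto intro!: eq_matI)
qed

lemma cartan_iff:
  "h \<in> cartan n \<longleftrightarrow> h \<in> pe n \<and> (\<forall>r<n+n. \<forall>s<n+n. r \<noteq> s \<longrightarrow> h $$ (r, s) = 0)"
proof
  assume h: "h \<in> cartan n"
  then show "h \<in> pe n \<and> (\<forall>r<n+n. \<forall>s<n+n. r \<noteq> s \<longrightarrow> h $$ (r, s) = 0)"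
    by (auto simp: cartan_subset_pe) (auto simp: cartan_def diagonal_mat_def)
next
  assume h: "h \<in> pe n \<and> (\<forall>r<n+n. \<forall>s<n+n. r \<noteq> s \<longrightarrow> h $$ (r, s) = 0)"
  define D where "D = mat n n (\<lambda>(r, s). h $$ (r, s))"
  have "h = four_block_mat D (0\<^sub>m n n) (0\<^sub>m n n) (- D)"
  proof (rule eq_matI)
    fix r s assume "r < dim_row (four_block_mat D (0\<^sub>m n n) (0\<^sub>m n n) (- D))"
      "s < dim_col (four_block_mat D (0\<^sub>m n n) (0\<^sub>m n n) (- D))"
    then have rs: "r < n + n" "s < n + n" by (auto simp: D_def)
    have "h $$ (r - n, r - n) = - h $$ (r, r)" if "\<not> r < n"
      using pe_swap[of h n r r] h rs that by (simp add: swap_half_def transpose_sign_def)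
    then show "h $$ (r, s) = four_block_mat D (0\<^sub>m n n) (0\<^sub>m n n) (- D) $$ (r, s)"
      using h rs by (cases "r = s") (auto simp: D_def)
  qed (use h pe_carrier in \<open>auto simp: D_def\<close>)
  then show "h \<in> cartan n"
    using h by (auto simp: cartan_def D_def diagonal_mat_def intro!: exI[of _ D])
qed

lemma cartan_diag:
  assumes "h \<in> cartan n" "a < n"
  shows "h $$ (n + a, n + a) = - h $$ (a, a)"
  using pe_swap[of h n a a] assms
  by (simp add: swap_half_def transpose_sign_def cartan_subset_pe add.commute)

definition diag_cartan :: "nat \<Rightarrow> (nat \<Rightarrow> complex) \<Rightarrow> complex mat" where
  "diag_cartan n c = mat (n + n) (n + n)
     (\<lambda>(r, s). if r = s then if r < n then c r else - c (r - n) else 0)"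

lemma diag_cartan_in_cartan: "diag_cartan n c \<in> cartan n"
  by (auto simp: cartan_iff diag_cartan_def swap_half_def transpose_sign_def intro!: peI split: if_splits)

lemma cartan_basis_eq_diag: "k < n \<Longrightarrow> cartan_basis n k = diag_cartan n (\<lambda>a. if a = k then 1 else 0)"
  by (rule eq_matI) (auto simp: cartan_basis_def diag_cartan_def)

lemma cartan_basis_in_cartan: "k < n \<Longrightarrow> cartan_basis n k \<in> cartan n"
  by (simp add: cartan_basis_eq_diag diag_cartan_in_cartan)

lemma eps_diag_cartan: "i < n \<Longrightarrow> eps i (diag_cartan n c) = c i"
  by (simp add: eps_def diag_cartan_def)

lemma eps_cartan_basis: "i < n \<Longrightarrow> k < n \<Longrightarrow> eps i (cartan_basis n k) = (if i = k then 1 else 0)"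
  by (simp add: cartan_basis_eq_diag eps_diag_cartan)

lemma sbracket_cartan_index:
  assumes "h \<in> cartan n" "r < n + n" "s < n + n"
  shows "sbracket n h X $$ (r, s) = (h $$ (r, r) - h $$ (s, s)) * X $$ (r, s)"
proof -
  have h: "h $$ (a, b) = 0" if "a \<noteq> b" "a < n + n" "b < n + n" for a b
    using assms(1) that by (simp add: cartan_iff)
  have "sbracket n h X $$ (r, s) =
      (\<Sum>t<n+n. h $$ (r, t) * X $$ (t, s)) - (\<Sum>t<n+n. koszul_sign n r t s * (X $$ (r, t) * h $$ (t, s)))"
    using assms by (simp add: sbracket_index sum_subtractf)
  also have "(\<Sum>t<n+n. h $$ (r, t) * X $$ (t, s)) = (\<Sum>t<n+n. if t = r then h $$ (r, r) * X $$ (r, s) else 0)"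
    by (rule sum.cong) (use assms h in auto)
  also have "(\<Sum>t<n+n. koszul_sign n r t s * (X $$ (r, t) * h $$ (t, s))) =
      (\<Sum>t<n+n. if t = s then X $$ (r, s) * h $$ (s, s) else 0)"
    by (rule sum.cong) (use assms h in \<open>auto simp: koszul_sign_def\<close>)
  finally show ?thesis using assms by (simp add: algebra_simps)
qed

text \<open>Bracketing with a diagonal matrix multiplies each entry by a scalar. So membership in a root
  space is a condition on the positions of the nonzero entries.\<close>

lemma root_space_iff:
  "x \<in> root_space n \<alpha> \<longleftrightarrow> x \<in> pe n \<and>
     (\<forall>h\<in>cartan n. \<forall>r<n+n. \<forall>s<n+n. x $$ (r, s) \<noteq> 0 \<longrightarrow> h $$ (r, r) - h $$ (s, s) = \<alpha> h)"
proof -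
  have "sbracket n h x = \<alpha> h \<cdot>\<^sub>m x \<longleftrightarrow>
      (\<forall>r<n+n. \<forall>s<n+n. x $$ (r, s) \<noteq> 0 \<longrightarrow> h $$ (r, r) - h $$ (s, s) = \<alpha> h)"
    if "x \<in> pe n" "h \<in> cartan n" for h
    using pe_carrier[OF that(1)] that(2)
    by (auto simp: mat_eq_iff sbracket_cartan_index)
  then show ?thesis
    by (auto simp: root_space_def)
qed

lemma root_space_subset_pe: "x \<in> root_space n \<alpha> \<Longrightarrow> x \<in> pe n"
  by (simp add: root_space_def)

lemma root_space_weight:
  "x \<in> root_space n \<alpha> \<Longrightarrow> h \<in> cartan n \<Longrightarrow> r < n + n \<Longrightarrow> s < n + n \<Longrightarrow> x $$ (r, s) \<noteq> 0 \<Longrightarrow>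
    h $$ (r, r) - h $$ (s, s) = \<alpha> h"
  by (simp add: root_space_iff)

lemma nonzero_entry:
  assumes "x \<in> carrier_mat N N" "x \<noteq> 0\<^sub>m N N"
  obtains r s where "r < N" "s < N" "x $$ (r, s) \<noteq> 0"
proof -
  have "\<not> (\<forall>r<N. \<forall>s<N. x $$ (r, s) = 0)"
    using assms by (auto simp: mat_eq_iff)
  then show ?thesis using that by blast
qed

lemma root_space_sbracket:
  assumes x: "x \<in> root_space n \<alpha>" and y: "y \<in> root_space n \<beta>"
  shows "sbracket n x y \<in> root_space n (wt_add \<alpha> \<beta>)"
  unfolding root_space_iff
proof (intro conjI ballI allI impI)
  show "sbracket n x y \<in> pe n"
    using x y by (intro pe_sbracket root_space_subset_pe)
next
  fix h r s assume h: "h \<in> cartan n" and rs: "r < n + n" "s < n + n"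
    and nz: "sbracket n x y $$ (r, s) \<noteq> 0"
  from nz rs show "h $$ (r, r) - h $$ (s, s) = wt_add \<alpha> \<beta> h"
  proof (cases rule: sbracket_entry_cases)
    case (1 t)
    then show ?thesis
      using root_space_weight[OF x h rs(1), of t] root_space_weight[OF y h _ rs(2), of t]
      by (simp add: wt_add_def algebra_simps)
  next
    case (2 t)
    then show ?thesis
      using root_space_weight[OF y h rs(1), of t] root_space_weight[OF x h _ rs(2), of t]
      by (simp add: wt_add_def algebra_simps)
  qed
qed

lemma roots_cases [consumes 1, case_names even plus minus]:
  assumes "\<alpha> \<in> roots n"
  obtains a b where "a < n" "b < n" "a \<noteq> b" "\<alpha> = wt_diff (eps a) (eps b)"
  | a b where "a \<le> b" "b < n" "\<alpha> = wt_add (eps a) (eps b)"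
  | a b where "a < b" "b < n" "\<alpha> = wt_neg (wt_add (eps a) (eps b))"
proof -
  from assms consider "\<alpha> \<in> even_roots n" | "\<alpha> \<in> odd_roots_plus n" | "\<alpha> \<in> odd_roots_minus n"
    by (auto simp: roots_def)
  then show ?thesis
  proof cases
    assume "\<alpha> \<in> even_roots n"
    then show ?thesis unfolding even_roots_def using that(1) by auto
  next
    assume "\<alpha> \<in> odd_roots_plus n"
    then show ?thesis unfolding odd_roots_plus_def using that(2) by auto
  next
    assume "\<alpha> \<in> odd_roots_minus n"
    then show ?thesis unfolding odd_roots_minus_def using that(3) by auto
  qed
qed

lemma wt_diff_eps_inject:
  assumes "\<And>h. h \<in> cartan n \<Longrightarrow> wt_diff (eps a) (eps b) h = wt_diff (eps c) (eps d) h"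
    and "a < n" "b < n" "a \<noteq> b" "c < n" "d < n"
  shows "a = c \<and> b = d"
  using assms(1)[OF cartan_basis_in_cartan[of a n]] assms(1)[OF cartan_basis_in_cartan[of b n]] assms(2-)
  by (simp add: wt_diff_def eps_cartan_basis split: if_splits)

lemma wt_add_eps_inject:
  assumes "\<And>h. h \<in> cartan n \<Longrightarrow> wt_add (eps a) (eps b) h = wt_add (eps c) (eps d) h"
    and "a \<le> b" "b < n" "c \<le> d" "d < n"
  shows "a = c \<and> b = d"
proof -
  have "(a = c \<or> a = d) \<and> (b = c \<or> b = d) \<and> (c = a \<or> c = b) \<and> (d = a \<or> d = b)"
    using assms(1)[OF cartan_basis_in_cartan[of a n]] assms(1)[OF cartan_basis_in_cartan[of b n]]
      assms(1)[OF cartan_basis_in_cartan[of c n]] assms(1)[OF cartan_basis_in_cartan[of d n]] assms(2-)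
    by (intro conjI; simp add: wt_add_def eps_cartan_basis split: if_splits)
  then show ?thesis using assms(2,4) by auto
qed

text \<open>The element of the Cartan subalgebra with all coordinates one separates the three kinds of
  roots.\<close>

lemma root_kind_values:
  "a < n \<Longrightarrow> b < n \<Longrightarrow> wt_diff (eps a) (eps b) (diag_cartan n (\<lambda>_. 1)) = 0"
  "a < n \<Longrightarrow> b < n \<Longrightarrow> wt_add (eps a) (eps b) (diag_cartan n (\<lambda>_. 1)) = 2"
  "wt_neg \<alpha> (diag_cartan n (\<lambda>_. 1)) = - \<alpha> (diag_cartan n (\<lambda>_. 1))"
  by (simp_all add: wt_diff_def wt_add_def wt_neg_def eps_diag_cartan)

lemma root_kinds_distinct:
  assumes "a < n" "b < n" "c < n" "d < n"
  shows "wt_diff (eps a) (eps b) \<noteq> wt_add (eps c) (eps d)"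
    "wt_diff (eps a) (eps b) \<noteq> wt_neg (wt_add (eps c) (eps d))"
    "wt_add (eps a) (eps b) \<noteq> wt_neg (wt_add (eps c) (eps d))"
  using root_kind_values(1)[OF assms(1,2)] root_kind_values(2)[OF assms(1,2)]
    root_kind_values(2)[OF assms(3,4)] root_kind_values(3)[of "wt_add (eps c) (eps d)" n]
  by auto

text \<open>Roots are functions on all matrices, whereas root vectors only determine their values on the
  Cartan subalgebra. For roots this makes no difference.\<close>

lemma roots_eqI:
  assumes \<alpha>: "\<alpha> \<in> roots n" and \<beta>: "\<beta> \<in> roots n" and eq: "\<And>h. h \<in> cartan n \<Longrightarrow> \<alpha> h = \<beta> h"
  shows "\<alpha> = \<beta>"
proof -
  note tr = eq[OF diag_cartan_in_cartan[of n "\<lambda>_. 1"]]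
  from \<alpha> show ?thesis
  proof (cases rule: roots_cases)
    case ab: (even a b)
    from \<beta> show ?thesis
    proof (cases rule: roots_cases)
      case (even c d)
      then show ?thesis using wt_diff_eps_inject[of n a b c d] eq ab by auto
    qed (use tr ab in \<open>simp_all add: root_kind_values\<close>)
  next
    case ab: (plus a b)
    from \<beta> show ?thesis
    proof (cases rule: roots_cases)
      case (plus c d)
      then show ?thesis using wt_add_eps_inject[of n a b c d] eq ab by auto
    qed (use tr ab in \<open>simp_all add: root_kind_values\<close>)
  next
    case ab: (minus a b)
    from \<beta> show ?thesis
    proof (cases rule: roots_cases)
      case (minus c d)
      then have "a = c \<and> b = d"
        using wt_add_eps_inject[of n a b c d] eq ab by (auto simp: wt_neg_def)
      then show ?thesis using ab minus by simp
    qed (use tr ab in \<open>simp_all add: root_kind_values\<close>)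
  qed
qed

lemma root_nonzero_on_cartan:
  assumes "\<alpha> \<in> roots n"
  shows "\<exists>h\<in>cartan n. \<alpha> h \<noteq> 0"
  using assms
proof (cases rule: roots_cases)
  case (even a b)
  then have "\<alpha> (cartan_basis n a) \<noteq> 0" by (simp add: wt_diff_def eps_cartan_basis)
  with even show ?thesis using cartan_basis_in_cartan by blast
next
  case (plus a b)
  then have "a < n" by simp
  with plus have "\<alpha> (cartan_basis n a) \<noteq> 0" by (simp add: wt_add_def eps_cartan_basis)
  with \<open>a < n\<close> show ?thesis using cartan_basis_in_cartan by blast
next
  case (minus a b)
  then have "a < n" by simp
  with minus have "\<alpha> (cartan_basis n a) \<noteq> 0" by (simp add: wt_neg_def wt_add_def eps_cartan_basis)
  with \<open>a < n\<close> show ?thesis using cartan_basis_in_cartan by blast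
qed

text \<open>The weight of the matrix unit at \<open>(r, s)\<close>. The indices of an odd weight are sorted because
  the roots in \<open>roots n\<close> are given by sorted pairs.\<close>

definition position_weight :: "nat \<Rightarrow> nat \<Rightarrow> nat \<Rightarrow> weight" where
  "position_weight n r s =
     (if r < n then if s < n then wt_diff (eps r) (eps s) else wt_add (eps (min r (s - n))) (eps (max r (s - n)))
      else if s < n then wt_neg (wt_add (eps (min (r - n) s)) (eps (max (r - n) s)))
      else wt_diff (eps (s - n)) (eps (r - n)))"

lemma position_weight_cartan:
  assumes "h \<in> cartan n" "r < n + n" "s < n + n"
  shows "position_weight n r s h = h $$ (r, r) - h $$ (s, s)"
proof -
  have "h $$ (a, a) = - h $$ (a - n, a - n)" if "\<not> a < n" "a < n + n" for a
    using cartan_diag[OF assms(1), of "a - n"] that by simp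
  then show ?thesis
    using assms(2-)
    by (cases "r < n"; cases "s < n")
      (simp_all add: position_weight_def wt_diff_def wt_add_def wt_neg_def eps_def min_def max_def)
qed

lemma wt_diff_root: "a < n \<Longrightarrow> b < n \<Longrightarrow> a \<noteq> b \<Longrightarrow> wt_diff (eps a) (eps b) \<in> roots n"
  by (auto simp: roots_def even_roots_def)

lemma wt_add_root: "a \<le> b \<Longrightarrow> b < n \<Longrightarrow> wt_add (eps a) (eps b) \<in> roots n"
  by (auto simp: roots_def odd_roots_plus_def)

lemma wt_neg_root: "a < b \<Longrightarrow> b < n \<Longrightarrow> wt_neg (wt_add (eps a) (eps b)) \<in> roots n"
  by (auto simp: roots_def odd_roots_minus_def)

lemma position_weight_root:
  assumes x: "x \<in> pe n" and rs: "r < n + n" "s < n + n" "r \<noteq> s" "x $$ (r, s) \<noteq> 0"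
  shows "position_weight n r s \<in> roots n"
proof -
  have "r - n \<noteq> s" if "s < n" "\<not> r < n"
    using pe_swap[OF x rs(1,2)] rs that by (auto simp: swap_half_def transpose_sign_def)
  then show ?thesis
    using rs(1-3)
    by (cases "r < n"; cases "s < n")
      (auto simp: position_weight_def min_def max_def intro!: wt_diff_root wt_add_root wt_neg_root)
qed

text \<open>A nonzero entry off the diagonal of an element of \<open>pe n\<close> has a root as its weight, and roots are determined by
  their values on the Cartan subalgebra. Diagonal positions are excluded because no root vanishes there.\<close>

lemma root_space_support:
  assumes \<alpha>: "\<alpha> \<in> roots n" and x: "x \<in> root_space n \<alpha>"
    and rs: "r < n + n" "s < n + n" "x $$ (r, s) \<noteq> 0"
  shows "r \<noteq> s" "position_weight n r s = \<alpha>"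
proof -
  obtain h where "h \<in> cartan n" "\<alpha> h \<noteq> 0"
    using root_nonzero_on_cartan[OF \<alpha>] by blast
  with root_space_weight[OF x this(1) rs] show "r \<noteq> s" by auto
  show "position_weight n r s = \<alpha>"
  proof (rule roots_eqI[OF position_weight_root[OF root_space_subset_pe[OF x] rs(1,2) \<open>r \<noteq> s\<close> rs(3)] \<alpha>])
    fix h assume "h \<in> cartan n"
    then show "position_weight n r s h = \<alpha> h"
      using rs root_space_weight[OF x _ rs] by (simp add: position_weight_cartan)
  qed
qed

lemma position_weight_kind:
  assumes "r < n + n" "s < n + n"
  shows "position_weight n r s (diag_cartan n (\<lambda>_. 1)) = (if r < n then 1 else - 1) - (if s < n then 1 else - 1)"
  unfolding position_weight_cartan[OF diag_cartan_in_cartan assms]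
  using assms by (simp add: diag_cartan_def)

lemma support_even:
  assumes x: "x \<in> root_space n (wt_diff (eps a) (eps b))" and ab: "a < n" "b < n" "a \<noteq> b"
    and rs: "r < n + n" "s < n + n" "x $$ (r, s) \<noteq> 0"
  shows "r = a \<and> s = b \<or> r = n + b \<and> s = n + a"
proof -
  have eq: "position_weight n r s = wt_diff (eps a) (eps b)"
    using root_space_support(2)[OF wt_diff_root x rs] ab by blast
  have "r < n \<longleftrightarrow> s < n"
    using position_weight_kind[OF rs(1,2)] root_kind_values(1)[OF ab(1,2)]
    by (auto simp: eq split: if_splits)
  then consider "r < n" "s < n" | "\<not> r < n" "\<not> s < n" by blast
  then show ?thesis
  proof cases
    case 1
    then have "wt_diff (eps a) (eps b) = wt_diff (eps r) (eps s)" using eq by (simp add: position_weight_def)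
    with wt_diff_eps_inject[of n a b r s] 1 ab show ?thesis by simp
  next
    case 2
    then have "wt_diff (eps a) (eps b) = wt_diff (eps (s - n)) (eps (r - n))" using eq by (simp add: position_weight_def)
    with wt_diff_eps_inject[of n a b "s - n" "r - n"] 2 ab rs show ?thesis by auto
  qed
qed

lemma support_plus:
  assumes x: "x \<in> root_space n (wt_add (eps a) (eps b))" and ab: "a \<le> b" "b < n"
    and rs: "r < n + n" "s < n + n" "x $$ (r, s) \<noteq> 0"
  shows "r = a \<and> s = n + b \<or> r = b \<and> s = n + a"
proof -
  have eq: "position_weight n r s = wt_add (eps a) (eps b)"
    using root_space_support(2)[OF wt_add_root x rs] ab by blast
  have rs': "r < n" "\<not> s < n"
    using position_weight_kind[OF rs(1,2)] root_kind_values(2)[of a n b] ab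
    by (auto simp: eq split: if_splits)
  then have "wt_add (eps (min r (s - n))) (eps (max r (s - n))) = wt_add (eps a) (eps b)"
    using eq by (simp add: position_weight_def)
  then have "min r (s - n) = a \<and> max r (s - n) = b"
    using rs' rs ab by (intro wt_add_eps_inject[of n]) (simp, linarith+)
  then show ?thesis
    using rs' by (cases "r \<le> s - n") (auto simp: min_def max_def)
qed

lemma support_minus:
  assumes x: "x \<in> root_space n (wt_neg (wt_add (eps a) (eps b)))" and ab: "a < b" "b < n"
    and rs: "r < n + n" "s < n + n" "x $$ (r, s) \<noteq> 0"
  shows "r = n + a \<and> s = b \<or> r = n + b \<and> s = a"
proof -
  have eq: "position_weight n r s = wt_neg (wt_add (eps a) (eps b))"
    using root_space_support(2)[OF wt_neg_root x rs] ab by blast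
  have rs': "\<not> r < n" "s < n"
    using position_weight_kind[OF rs(1,2)] root_kind_values(2)[of a n b]
      root_kind_values(3)[of "wt_add (eps a) (eps b)" n] ab
    by (auto simp: eq split: if_splits)
  then have "wt_add (eps (min (r - n) s)) (eps (max (r - n) s)) h = wt_add (eps a) (eps b) h" for h
    using fun_cong[OF eq, of h] by (simp add: position_weight_def wt_neg_def)
  then have "min (r - n) s = a \<and> max (r - n) s = b"
    using rs' rs ab by (intro wt_add_eps_inject[of n]) (simp, linarith+)
  then show ?thesis
    using rs' by (cases "r - n \<le> s") (auto simp: min_def max_def)
qed

lemma pe_partI:
  assumes "x \<in> pe n" "\<And>r s. r < n + n \<Longrightarrow> s < n + n \<Longrightarrow> x $$ (r, s) \<noteq> 0 \<Longrightarrow> ((r < n) \<noteq> (s < n)) = d"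
  shows "x \<in> pe_part n d"
  unfolding pe_part_def
proof (intro CollectI conjI assms(1) eq_matI)
  fix r s assume "r < dim_row x" "s < dim_col x"
  then have "r < n + n" "s < n + n" using pe_carrier[OF assms(1)] by auto
  then show "parity_part n d x $$ (r, s) = x $$ (r, s)"
    using assms(2)[of r s] by (auto simp: parity_part_index)
qed (use pe_carrier[OF assms(1)] in auto)

lemma cartan_even: "h \<in> cartan n \<Longrightarrow> h \<in> pe_part n False"
  by (rule pe_partI) (auto simp: cartan_iff)

lemma root_space_plus_odd:
  assumes x: "x \<in> root_space n (wt_add (eps a) (eps b))" and ab: "a \<le> b" "b < n"
  shows "x \<in> pe_part n True"
proof (rule pe_partI[OF root_space_subset_pe[OF x]])
  fix r s assume "r < n + n" "s < n + n" "x $$ (r, s) \<noteq> 0"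
  from support_plus[OF x ab this] show "((r < n) \<noteq> (s < n)) = True" using ab by auto
qed

lemma root_space_minus_odd:
  assumes x: "x \<in> root_space n (wt_neg (wt_add (eps a) (eps b)))" and ab: "a < b" "b < n"
  shows "x \<in> pe_part n True"
proof (rule pe_partI[OF root_space_subset_pe[OF x]])
  fix r s assume "r < n + n" "s < n + n" "x $$ (r, s) \<noteq> 0"
  from support_minus[OF x ab this] show "((r < n) \<noteq> (s < n)) = True" using ab by auto
qed

lemma root_space_even_even:
  assumes x: "x \<in> root_space n (wt_diff (eps a) (eps b))" and ab: "a < n" "b < n" "a \<noteq> b"
  shows "x \<in> pe_part n False"
proof (rule pe_partI[OF root_space_subset_pe[OF x]])
  fix r s assume "r < n + n" "s < n + n" "x $$ (r, s) \<noteq> 0"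
  from support_even[OF x ab this] show "((r < n) \<noteq> (s < n)) = False" using ab by auto
qed

lemma root_space_homogeneous:
  assumes "\<alpha> \<in> roots n" "x \<in> root_space n \<alpha>"
  shows "\<exists>d. x \<in> pe_part n d"
  using assms(1)
proof (cases rule: roots_cases)
  case (even a b)
  then show ?thesis using root_space_even_even assms(2) by blast
next
  case (plus a b)
  then show ?thesis using root_space_plus_odd assms(2) by blast
next
  case (minus a b)
  then show ?thesis using root_space_minus_odd assms(2) by blast
qed

section \<open>The order of the odd roots along the chain\<close>

text \<open>The order in which the roots \<open>\<epsilon>\<^sub>a + \<epsilon>\<^sub>b\<close> with \<open>a \<le> b\<close> occur along the chain: lexicographic,
  with the larger index \<open>b\<close> compared first.\<close>

definition index_before :: "nat \<times> nat \<Rightarrow> nat \<times> nat \<Rightarrow> bool" where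
  "index_before x y \<longleftrightarrow> snd x < snd y \<or> snd x = snd y \<and> fst x < fst y"

definition gamma_indices :: "nat \<Rightarrow> (nat \<times> nat) list" where
  "gamma_indices n = concat (map (\<lambda>j. map (\<lambda>i. (i, j)) [0..<Suc j]) [0..<n])"

lemma gamma_seq_eq: "gamma_seq n = map (\<lambda>(i, j). wt_add (eps i) (eps j)) (gamma_indices n)"
  by (simp add: gamma_seq_def gamma_indices_def map_concat comp_def del: upt_Suc)

lemma set_gamma_indices: "set (gamma_indices n) = {(i, j). i \<le> j \<and> j < n}"
  by (auto simp: gamma_indices_def simp del: upt_Suc)

lemma sorted_gamma_indices: "sorted_wrt index_before (gamma_indices n)"
proof (induction n)
  case (Suc n)
  have "gamma_indices (Suc n) = gamma_indices n @ map (\<lambda>i. (i, n)) [0..<Suc n]"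
    by (simp add: gamma_indices_def)
  moreover have "sorted_wrt index_before (map (\<lambda>i. (i, n)) [0..<Suc n])"
    by (auto simp: sorted_wrt_map index_before_def simp del: upt_Suc intro: sorted_wrt_mono_rel[OF _ sorted_wrt_upt])
  ultimately show ?case
    using Suc by (auto simp: sorted_wrt_append set_gamma_indices simp del: upt_Suc) (auto simp: index_before_def)
qed (simp add: gamma_indices_def)

lemma gamma_indices_nth_less_iff:
  assumes "r < length (gamma_indices n)" "p < length (gamma_indices n)"
  shows "index_before (gamma_indices n ! r) (gamma_indices n ! p) \<longleftrightarrow> r < p"
proof -
  have "index_before (gamma_indices n ! r) (gamma_indices n ! p)" if "r < p"
    using sorted_wrt_nth_less[OF sorted_gamma_indices] that assms by blast
  moreover have "index_before (gamma_indices n ! p) (gamma_indices n ! r)" if "p < r"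
    using sorted_wrt_nth_less[OF sorted_gamma_indices] that assms by blast
  ultimately show ?thesis
    by (metis index_before_def less_irrefl less_asym' linorder_neqE_nat)
qed

lemma gamma_seq_nth:
  assumes "p < length (gamma_seq n)"
  obtains i j where "i \<le> j" "j < n" "gamma_indices n ! p = (i, j)" "gamma_seq n ! p = wt_add (eps i) (eps j)"
proof -
  have p: "p < length (gamma_indices n)" using assms by (simp add: gamma_seq_eq)
  obtain i j where ij: "gamma_indices n ! p = (i, j)" by fastforce
  have "(i, j) \<in> set (gamma_indices n)" using p ij nth_mem by metis
  then show ?thesis
    using that[of i j] ij p by (auto simp: set_gamma_indices gamma_seq_eq)
qed

lemma gamma_seq_nth_indices:
  assumes "p < length (gamma_seq n)" "gamma_seq n ! p = wt_add (eps i) (eps j)" "i \<le> j" "j < n"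
  shows "gamma_indices n ! p = (i, j)"
proof -
  obtain a b where ab: "a \<le> b" "b < n" "gamma_indices n ! p = (a, b)" "gamma_seq n ! p = wt_add (eps a) (eps b)"
    using gamma_seq_nth[OF assms(1)] .
  have "wt_add (eps a) (eps b) = wt_add (eps i) (eps j)"
    using ab(4) assms(2) by (rule trans[OF sym])
  from wt_add_eps_inject[OF fun_cong[OF this] ab(1,2) assms(3,4)] ab(3) show ?thesis
    by simp
qed

lemma chain_odd_roots_earlier:
  "r < p \<Longrightarrow> r < length (gamma_seq n) \<Longrightarrow> gamma_seq n ! r \<in> chain_odd_roots n p"
  unfolding chain_odd_roots_def by (rule UnI1, rule CollectI, rule exI[of _ r]) simp

lemma chain_odd_roots_later:
  assumes "p \<le> r" "r < length (gamma_seq n)" "a < b" "b < n" "gamma_seq n ! r = wt_add (eps a) (eps b)"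
  shows "wt_neg (gamma_seq n ! r) \<in> chain_odd_roots n p"
  unfolding chain_odd_roots_def using assms by (intro UnI2 CollectI exI[of _ r] conjI exI[of _ a] exI[of _ b]) simp_all

lemma chain_odd_roots_cases [consumes 1, case_names earlier later]:
  assumes "\<alpha> \<in> chain_odd_roots n p"
  obtains r where "r < p" "r < length (gamma_seq n)" "\<alpha> = gamma_seq n ! r"
  | r a b where "p \<le> r" "r < length (gamma_seq n)" "\<alpha> = wt_neg (gamma_seq n ! r)" "a < b" "b < n"
      "gamma_seq n ! r = wt_add (eps a) (eps b)"
proof -
  from assms consider "\<alpha> \<in> {gamma_seq n ! r | r. r < p \<and> r < length (gamma_seq n)}"
    | "\<alpha> \<in> {wt_neg (gamma_seq n ! r) | r. p \<le> r \<and> r < length (gamma_seq n) \<and>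
        (\<exists>i j. i < j \<and> j < n \<and> gamma_seq n ! r = wt_add (eps i) (eps j))}"
    unfolding chain_odd_roots_def by (elim UnE)
  then show ?thesis
  proof cases
    case 1
    then show ?thesis using that(1) by auto
  next
    case 2
    then show ?thesis using that(2) by auto
  qed
qed

definition borel_roots :: "nat \<Rightarrow> nat \<Rightarrow> weight set" where
  "borel_roots n p = pos_even_roots n \<union> chain_odd_roots n p"

lemma wt_diff_in_borel_roots: "a < b \<Longrightarrow> b < n \<Longrightarrow> wt_diff (eps a) (eps b) \<in> borel_roots n p"
  by (auto simp: borel_roots_def pos_even_roots_def)

lemma gamma_seq_index:
  assumes "a \<le> b" "b < n"
  obtains r where "r < length (gamma_seq n)" "gamma_indices n ! r = (a, b)" "gamma_seq n ! r = wt_add (eps a) (eps b)"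
proof -
  have "(a, b) \<in> set (gamma_indices n)" using assms by (simp add: set_gamma_indices)
  then obtain r where "r < length (gamma_indices n)" "gamma_indices n ! r = (a, b)"
    by (meson in_set_conv_nth)
  then show ?thesis using that by (simp add: gamma_seq_eq)
qed

lemma chain_odd_roots_plusI:
  assumes "p < length (gamma_seq n)" "gamma_indices n ! p = (i, j)"
    and "a \<le> b" "b < n" "index_before (a, b) (i, j)"
  shows "wt_add (eps a) (eps b) \<in> chain_odd_roots n p"
proof -
  obtain r where r: "r < length (gamma_seq n)" "gamma_indices n ! r = (a, b)" "gamma_seq n ! r = wt_add (eps a) (eps b)"
    using gamma_seq_index assms(3,4) by blast
  then have "r < p"
    using gamma_indices_nth_less_iff[of r n p] assms by (simp add: gamma_seq_eq)
  then show ?thesis using chain_odd_roots_earlier[of r p n] r by simp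
qed

lemma chain_odd_roots_minusI:
  assumes "p < length (gamma_seq n)" "gamma_indices n ! p = (i, j)"
    and "a < b" "b < n" "\<not> index_before (a, b) (i, j)"
  shows "wt_neg (wt_add (eps a) (eps b)) \<in> chain_odd_roots n p"
proof -
  obtain r where r: "r < length (gamma_seq n)" "gamma_indices n ! r = (a, b)" "gamma_seq n ! r = wt_add (eps a) (eps b)"
    using gamma_seq_index assms(3,4) by (metis less_imp_le)
  then have "p \<le> r"
    using gamma_indices_nth_less_iff[of r n p] assms by (simp add: gamma_seq_eq)
  then show ?thesis using chain_odd_roots_later[of p r n a b] r assms(3,4) by simp
qed

lemma borel_roots_cases [consumes 3, case_names even plus minus]:
  assumes "\<alpha> \<in> borel_roots n p" "p < length (gamma_seq n)" "gamma_indices n ! p = (i, j)"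
  obtains a b where "a < b" "b < n" "\<alpha> = wt_diff (eps a) (eps b)"
  | a b where "a \<le> b" "b < n" "index_before (a, b) (i, j)" "\<alpha> = wt_add (eps a) (eps b)"
  | a b where "a < b" "b < n" "\<not> index_before (a, b) (i, j)" "\<alpha> = wt_neg (wt_add (eps a) (eps b))"
proof (cases "\<alpha> \<in> pos_even_roots n")
  case True
  then show ?thesis using that(1) by (auto simp: pos_even_roots_def)
next
  case False
  with assms(1) have "\<alpha> \<in> chain_odd_roots n p" by (simp add: borel_roots_def)
  then show ?thesis
  proof (cases rule: chain_odd_roots_cases)
    case 2: (earlier r)
    then obtain a b where "a \<le> b" "b < n" "gamma_indices n ! r = (a, b)" "\<alpha> = wt_add (eps a) (eps b)"
      using gamma_seq_nth by metis
    then show ?thesis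
      using 2 assms gamma_indices_nth_less_iff[of r n p] that(2) by (simp add: gamma_seq_eq)
  next
    case 3: (later r a b)
    then have "gamma_indices n ! r = (a, b)" using gamma_seq_nth_indices[of r n a b] by simp
    then show ?thesis
      using 3 assms gamma_indices_nth_less_iff[of r n p] that(3) by (simp add: gamma_seq_eq)
  qed
qed

lemma borel_roots_subset_roots: "borel_roots n p \<subseteq> roots n"
proof
  fix \<alpha> assume \<alpha>: "\<alpha> \<in> borel_roots n p"
  show "\<alpha> \<in> roots n"
  proof (cases "\<alpha> \<in> pos_even_roots n")
    case True
    then show ?thesis by (auto simp: pos_even_roots_def intro: wt_diff_root)
  next
    case False
    with \<alpha> have "\<alpha> \<in> chain_odd_roots n p" by (simp add: borel_roots_def)
    then show ?thesis
    proof (cases rule: chain_odd_roots_cases)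
      case (earlier r)
      then show ?thesis using gamma_seq_nth[of r n] wt_add_root by metis
    next
      case (later r a b)
      then show ?thesis by (simp add: wt_neg_root)
    qed
  qed
qed

lemma wt_neg_inject: "wt_neg \<mu> = wt_neg \<nu> \<longleftrightarrow> \<mu> = \<nu>"
  by (auto simp: wt_neg_def fun_eq_iff)

lemma borel_roots_Suc:
  assumes p: "p < length (gamma_seq n)" and \<alpha>: "\<alpha> \<in> borel_roots n (Suc p)"
  shows "\<alpha> = gamma_seq n ! p \<or> \<alpha> \<in> borel_roots n p \<and> \<alpha> \<noteq> wt_neg (gamma_seq n ! p)"
proof -
  obtain i j where ij: "i \<le> j" "j < n" "gamma_indices n ! p = (i, j)" "gamma_seq n ! p = wt_add (eps i) (eps j)"
    using gamma_seq_nth[OF p] .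
  show ?thesis
  proof (cases "\<alpha> \<in> pos_even_roots n")
    case True
    then obtain a b where "a < b" "b < n" "\<alpha> = wt_diff (eps a) (eps b)" by (auto simp: pos_even_roots_def)
    then have "\<alpha> \<noteq> wt_neg (gamma_seq n ! p)" using ij root_kinds_distinct(2)[of a n b i j] by simp
    with True show ?thesis by (simp add: borel_roots_def)
  next
    case False
    with \<alpha> have "\<alpha> \<in> chain_odd_roots n (Suc p)" by (simp add: borel_roots_def)
    then show ?thesis
    proof (cases rule: chain_odd_roots_cases)
      case (earlier r)
      obtain a b where "a \<le> b" "b < n" "\<alpha> = wt_add (eps a) (eps b)"
        using gamma_seq_nth[OF earlier(2)] earlier(3) by metis
      then have "\<alpha> \<noteq> wt_neg (gamma_seq n ! p)"
        using ij root_kinds_distinct(3)[of a n b i j] by simp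
      moreover have "r = p \<or> \<alpha> \<in> chain_odd_roots n p"
        using earlier chain_odd_roots_earlier[of r p n] by (cases "r = p") simp_all
      ultimately show ?thesis using earlier by (auto simp: borel_roots_def)
    next
      case (later r a b)
      have "\<alpha> \<noteq> wt_neg (gamma_seq n ! p)"
      proof
        assume "\<alpha> = wt_neg (gamma_seq n ! p)"
        then have "gamma_seq n ! p = wt_add (eps a) (eps b)"
          using later by (simp add: wt_neg_inject)
        then have "gamma_indices n ! p = gamma_indices n ! r"
          using gamma_seq_nth_indices[of p n a b] gamma_seq_nth_indices[of r n a b] p later by simp
        then show False
          using gamma_indices_nth_less_iff[of p n r] gamma_indices_nth_less_iff[of p n p] later p
          by (simp add: gamma_seq_eq)
      qed
      moreover have "\<alpha> \<in> chain_odd_roots n p"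
        using later chain_odd_roots_later[of p r n a b] by simp
      ultimately show ?thesis by (simp add: borel_roots_def)
    qed
  qed
qed

section \<open>Bracketing with the next odd root\<close>

lemma root_space_zero: "0\<^sub>m (n + n) (n + n) \<in> root_space n \<alpha>"
  by (simp add: root_space_iff pe_zero)

lemma sbracket_plus_plus:
  assumes x: "x \<in> root_space n (wt_add (eps a) (eps b))" and ab: "a \<le> b" "b < n"
    and y: "y \<in> root_space n (wt_add (eps c) (eps d))" and cd: "c \<le> d" "d < n"
  shows "sbracket n x y = 0\<^sub>m (n + n) (n + n)"
proof (rule ccontr)
  assume "\<not> ?thesis"
  then obtain r s where rs: "r < n + n" "s < n + n" "sbracket n x y $$ (r, s) \<noteq> 0"
    using nonzero_entry[OF sbracket_carrier] by metis
  from rs(3,1,2) show False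
  proof (cases rule: sbracket_entry_cases)
    case (1 t)
    with support_plus[OF x ab rs(1), of t] support_plus[OF y cd _ rs(2), of t] ab cd show False by auto
  next
    case (2 t)
    with support_plus[OF y cd rs(1), of t] support_plus[OF x ab _ rs(2), of t] ab cd show False by auto
  qed
qed

lemma sbracket_even_plus_support:
  assumes x: "x \<in> root_space n (wt_diff (eps a) (eps b))" and ab: "a < n" "b < n" "a \<noteq> b"
    and y: "y \<in> root_space n (wt_add (eps c) (eps d))" and cd: "c \<le> d" "d < n"
    and nz: "sbracket n x y \<noteq> 0\<^sub>m (n + n) (n + n)"
  shows "b = c \<or> b = d"
proof -
  obtain r s where rs: "r < n + n" "s < n + n" "sbracket n x y $$ (r, s) \<noteq> 0"
    using nonzero_entry[OF sbracket_carrier nz] by metis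
  from rs(3,1,2) show ?thesis
  proof (cases rule: sbracket_entry_cases)
    case (1 t)
    with support_even[OF x ab rs(1), of t] support_plus[OF y cd _ rs(2), of t] ab cd show ?thesis by auto
  next
    case (2 t)
    with support_plus[OF y cd rs(1), of t] support_even[OF x ab _ rs(2), of t] ab cd show ?thesis by auto
  qed
qed

lemma sbracket_minus_plus_support:
  assumes x: "x \<in> root_space n (wt_neg (wt_add (eps a) (eps b)))" and ab: "a < b" "b < n"
    and y: "y \<in> root_space n (wt_add (eps c) (eps d))" and cd: "c \<le> d" "d < n"
    and nz: "sbracket n x y \<noteq> 0\<^sub>m (n + n) (n + n)"
  shows "a = c \<or> a = d \<or> b = c \<or> b = d"
proof -
  obtain r s where rs: "r < n + n" "s < n + n" "sbracket n x y $$ (r, s) \<noteq> 0"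
    using nonzero_entry[OF sbracket_carrier nz] by metis
  from rs(3,1,2) show ?thesis
  proof (cases rule: sbracket_entry_cases)
    case (1 t)
    with support_minus[OF x ab rs(1), of t] support_plus[OF y cd _ rs(2), of t] ab cd show ?thesis by auto
  next
    case (2 t)
    with support_plus[OF y cd rs(1), of t] support_minus[OF x ab _ rs(2), of t] ab cd show ?thesis by auto
  qed
qed

text \<open>Let \<open>\<gamma> = \<epsilon>\<^sub>i + \<epsilon>\<^sub>j\<close>. Two odd roots of the form \<open>\<epsilon>\<^sub>a + \<epsilon>\<^sub>b\<close> have bracket zero. A positive even root
  \<open>\<epsilon>\<^sub>a - \<epsilon>\<^sub>b\<close> interacts with \<open>\<gamma>\<close> only if \<open>b\<close> is \<open>i\<close> or \<open>j\<close>; it then replaces this index by the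
  smaller \<open>a\<close>, which gives a root that occurs earlier in the chain. A root \<open>-(\<epsilon>\<^sub>a + \<epsilon>\<^sub>b)\<close> whose pair comes after
  \<open>(i, j)\<close> interacts only if it shares an index with \<open>\<gamma>\<close>; the sum is then \<open>\<epsilon>\<^sub>c - \<epsilon>\<^sub>d\<close>, where \<open>c\<close> is the
  remaining index of \<open>\<gamma>\<close> and \<open>d\<close> that of the other root, and the order of the pairs gives \<open>c < d\<close>.\<close>

lemma borel_roots_bracket_gamma:
  assumes p: "p < length (gamma_seq n)"
    and \<alpha>: "\<alpha> \<in> borel_roots n p" "\<alpha> \<noteq> wt_neg (gamma_seq n ! p)"
    and x: "x \<in> root_space n \<alpha>" and f: "f \<in> root_space n (gamma_seq n ! p)"
  shows "\<exists>\<beta>\<in>borel_roots n p. \<beta> \<noteq> wt_neg (gamma_seq n ! p) \<and> sbracket n x f \<in> root_space n \<beta>"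
proof -
  obtain i j where ij: "i \<le> j" "j < n" "gamma_indices n ! p = (i, j)" "gamma_seq n ! p = wt_add (eps i) (eps j)"
    using gamma_seq_nth[OF p] .
  note f' = f[unfolded ij(4)]
  note y = root_space_sbracket[OF x f']
  show ?thesis
  proof (cases "sbracket n x f = 0\<^sub>m (n + n) (n + n)")
    case True
    then have "sbracket n x f \<in> root_space n \<alpha>" using root_space_zero by simp
    then show ?thesis using \<alpha> by blast
  next
    case nz: False
    have diff: ?thesis if "wt_add \<alpha> (wt_add (eps i) (eps j)) = wt_diff (eps c) (eps d)" "c < d" "d < n" for c d
    proof (intro bexI conjI)
      show "wt_diff (eps c) (eps d) \<in> borel_roots n p"
        using that by (intro wt_diff_in_borel_roots)
      show "wt_diff (eps c) (eps d) \<noteq> wt_neg (gamma_seq n ! p)"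
        unfolding ij(4) using that ij by (intro root_kinds_distinct) simp_all
      show "sbracket n x f \<in> root_space n (wt_diff (eps c) (eps d))"
        using y that by simp
    qed
    have plus: ?thesis
      if "wt_add \<alpha> (wt_add (eps i) (eps j)) = wt_add (eps c) (eps d)" "c \<le> d" "d < n" "index_before (c, d) (i, j)" for c d
    proof (intro bexI conjI)
      show "wt_add (eps c) (eps d) \<in> borel_roots n p"
        using chain_odd_roots_plusI[OF p ij(3) that(2-4)] by (simp add: borel_roots_def)
      show "wt_add (eps c) (eps d) \<noteq> wt_neg (gamma_seq n ! p)"
        unfolding ij(4) using that ij by (intro root_kinds_distinct) simp_all
      show "sbracket n x f \<in> root_space n (wt_add (eps c) (eps d))"
        using y that by simp
    qed
    from \<alpha>(1) p ij(3) show ?thesis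
    proof (cases rule: borel_roots_cases)
      case (even a b)
      have ab: "a < n" "a \<noteq> b" using even by auto
      note x' = x[unfolded even(3)]
      have "b = i \<or> b = j"
        by (rule sbracket_even_plus_support[OF x' ab(1) even(2) ab(2) f' ij(1,2) nz])
      then show ?thesis
      proof
        assume b: "b = i"
        show ?thesis
          by (rule plus[of a j]) (use b even ij in \<open>auto simp: wt_add_def wt_diff_def index_before_def\<close>)
      next
        assume b: "b = j"
        show ?thesis
        proof (cases "a \<le> i")
          case True
          show ?thesis
            by (rule plus[of a i]) (use b even ij True in \<open>auto simp: wt_add_def wt_diff_def index_before_def\<close>)
        next
          case False
          then show ?thesis
            by (intro plus[of i a]) (use b even ij in \<open>auto simp: wt_add_def wt_diff_def index_before_def\<close>)
        qed
      qed
    next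
      case (plus a b)
      with sbracket_plus_plus[OF x[unfolded plus(4)] plus(1,2) f' ij(1,2)] nz show ?thesis by simp
    next
      case (minus a b)
      have ne: "(a, b) \<noteq> (i, j)" using \<alpha>(2) minus(4) ij(4) by auto
      consider "b = j" "i < a" | "a = i" "j < b" | "a = j" "j < b"
        using sbracket_minus_plus_support[OF x[unfolded minus(4)] minus(1,2) f' ij(1,2) nz] ne minus(1,3) ij(1)
        by (auto simp: index_before_def)
      then show ?thesis
      proof cases
        case 1
        then show ?thesis
          by (intro diff[of i a]) (use minus in \<open>auto simp: wt_add_def wt_diff_def wt_neg_def\<close>)
      next
        case 2
        then show ?thesis
          by (intro diff[of j b]) (use minus in \<open>auto simp: wt_add_def wt_diff_def wt_neg_def\<close>)
      next
        case 3
        then show ?thesis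
          by (intro diff[of i b]) (use minus ij in \<open>auto simp: wt_add_def wt_diff_def wt_neg_def\<close>)
      qed
    qed
  qed
qed

text \<open>The functional takes the values 2, 1 and -2 on \<open>\<epsilon>\<^sub>a\<close> for \<open>a < i\<close>, for \<open>i \<le> a < j\<close> and for
  \<open>j \<le> a\<close>. These are weakly decreasing, so negative even roots are at most zero; \<open>\<epsilon>\<^sub>a + \<epsilon>\<^sub>b\<close> has a
  nonnegative value if \<open>(a, b)\<close> comes before \<open>(i, j)\<close> and a negative or zero value otherwise. At \<open>(i, j)\<close>
  itself the value is -1 or -4.\<close>

lemma separating_functional:
  assumes p: "p < length (gamma_seq n)"
  obtains D where "D \<in> cartan n"
    and "\<And>\<alpha>. \<alpha> \<in> roots n \<Longrightarrow> \<alpha> \<notin> borel_roots n p \<Longrightarrow> \<exists>t\<le>0. \<alpha> D = complex_of_real t"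
    and "\<exists>t<0. (gamma_seq n ! p) D = complex_of_real t"
proof -
  obtain i j where ij: "i \<le> j" "j < n" "gamma_indices n ! p = (i, j)" "gamma_seq n ! p = wt_add (eps i) (eps j)"
    using gamma_seq_nth[OF p] .
  define c :: "nat \<Rightarrow> real" where "c a = (if a < i then 2 else if a < j then 1 else - 2)" for a
  define D where "D = diag_cartan n (\<lambda>a. complex_of_real (c a))"
  have eps: "eps a D = complex_of_real (c a)" if "a < n" for a
    using that by (simp add: D_def eps_diag_cartan)
  show ?thesis
  proof (rule that[of D])
    show "D \<in> cartan n" by (simp add: D_def diag_cartan_in_cartan)
    show "\<exists>t<0. (gamma_seq n ! p) D = complex_of_real t"
      using ij by (intro exI[of _ "c i + c j"]) (simp add: wt_add_def eps c_def)
    fix \<alpha> assume \<alpha>: "\<alpha> \<in> roots n" "\<alpha> \<notin> borel_roots n p"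
    from \<alpha>(1) show "\<exists>t\<le>0. \<alpha> D = complex_of_real t"
    proof (cases rule: roots_cases)
      case (even a b)
      then have "b < a" using \<alpha>(2) wt_diff_in_borel_roots[of a b n p] by fastforce
      then have "c a - c b \<le> 0" using ij(1) by (auto simp: c_def)
      then show ?thesis using even by (intro exI[of _ "c a - c b"]) (simp add: wt_diff_def eps)
    next
      case (plus a b)
      then have "\<not> index_before (a, b) (i, j)"
        using \<alpha>(2) chain_odd_roots_plusI[OF p ij(3)] by (auto simp: borel_roots_def)
      then have "c a + c b \<le> 0" using ij(1) plus(1) by (auto simp: c_def index_before_def)
      then show ?thesis using plus by (intro exI[of _ "c a + c b"]) (simp add: wt_add_def eps)
    next
      case (minus a b)
      then have "index_before (a, b) (i, j)"
        using \<alpha>(2) chain_odd_roots_minusI[OF p ij(3)] by (auto simp: borel_roots_def)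
      then have "- (c a + c b) \<le> 0" using ij(1) minus(1) by (auto simp: c_def index_before_def)
      then show ?thesis using minus by (intro exI[of _ "- (c a + c b)"]) (simp add: wt_neg_def wt_add_def eps)
    qed
  qed
qed

section \<open>Root decomposition and Borel subalgebras\<close>

lemma mat_span_entry:
  assumes "X \<in> mat_span n S" "X $$ (r, s) \<noteq> 0" "r < n + n" "s < n + n"
    and "S \<subseteq> carrier_mat (n + n) (n + n)"
  shows "\<exists>Y\<in>S. Y $$ (r, s) \<noteq> 0"
proof -
  have "X \<in> carrier_mat (n + n) (n + n) \<and> (X $$ (r, s) \<noteq> 0 \<longrightarrow> (\<exists>Y\<in>S. Y $$ (r, s) \<noteq> 0))"
    using assms(1) by (induction) (use assms(3-) in auto)
  then show ?thesis using assms(2) by blast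
qed

text \<open>A Borel subalgebra is a span, so its membership is not directly visible on root vectors. But a
  nonzero entry of an element of the span is already nonzero in a generator, and its position determines the
  root.\<close>

lemma root_in_borel_of:
  assumes \<alpha>: "\<alpha> \<in> roots n" and R: "pos_even_roots n \<union> R \<subseteq> roots n"
    and x: "x \<in> root_space n \<alpha>" "x \<in> borel_of n R" and nz: "x \<noteq> 0\<^sub>m (n + n) (n + n)"
  shows "\<alpha> \<in> pos_even_roots n \<union> R"
proof -
  obtain r s where rs: "r < n + n" "s < n + n" "x $$ (r, s) \<noteq> 0"
    using nonzero_entry[OF pe_carrier[OF root_space_subset_pe[OF x(1)]] nz] .
  have "cartan n \<union> (\<Union>\<alpha>\<in>pos_even_roots n \<union> R. root_space n \<alpha>) \<subseteq> carrier_mat (n + n) (n + n)"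
    using cartan_subset_pe root_space_subset_pe pe_carrier by blast
  from mat_span_entry[OF x(2)[unfolded borel_of_def] rs(3,1,2) this]
  obtain Y where Y: "Y $$ (r, s) \<noteq> 0" "Y \<in> cartan n \<union> (\<Union>\<alpha>\<in>pos_even_roots n \<union> R. root_space n \<alpha>)"
    by blast
  have "Y \<notin> cartan n"
    using Y(1) rs root_space_support(1)[OF \<alpha> x(1) rs] by (auto simp: cartan_iff)
  with Y obtain \<beta> where \<beta>: "\<beta> \<in> pos_even_roots n \<union> R" "Y \<in> root_space n \<beta>" by blast
  then have "\<beta> = \<alpha>"
    using root_space_support(2)[OF _ \<beta>(2) rs(1,2) Y(1)] root_space_support(2)[OF \<alpha> x(1) rs] R
    by blast
  with \<beta> show ?thesis by simp
qed

text \<open>The part of \<open>X\<close> supported on \<open>(r, s)\<close> and on its mirror image, which is the smallest part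
  containing the entry at \<open>(r, s)\<close> that still lies in \<open>pe n\<close>.\<close>

definition root_component :: "nat \<Rightarrow> complex mat \<Rightarrow> nat \<Rightarrow> nat \<Rightarrow> complex mat" where
  "root_component n X r s = mat (n + n) (n + n) (\<lambda>(a, b).
     if a = r \<and> b = s \<or> a = swap_half n s \<and> b = swap_half n r then X $$ (a, b) else 0)"

lemma root_component_pe:
  assumes X: "X \<in> pe n" and rs: "r < n + n" "s < n + n"
  shows "root_component n X r s \<in> pe n"
proof (rule peI)
  fix a b assume ab: "a < n + n" "b < n + n"
  have "swap_half n b = r \<and> swap_half n a = s \<or> swap_half n b = swap_half n s \<and> swap_half n a = swap_half n r
      \<longleftrightarrow> a = r \<and> b = s \<or> a = swap_half n s \<and> b = swap_half n r"
    using rs ab by (metis swap_half_swap_half)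
  then show "root_component n X r s $$ (swap_half n b, swap_half n a) =
      transpose_sign n a b * root_component n X r s $$ (a, b)"
    using ab pe_swap[OF X ab] by (simp add: root_component_def swap_half_less)
qed (simp add: root_component_def)

lemma cartan_swap:
  assumes "h \<in> cartan n" "r < n + n"
  shows "h $$ (swap_half n r, swap_half n r) = - h $$ (r, r)"
  using pe_swap[OF cartan_subset_pe[OF assms(1)] assms(2) assms(2)] by (simp add: transpose_sign_def)

lemma root_component_root_space:
  assumes X: "X \<in> pe n" and rs: "r < n + n" "s < n + n"
  shows "root_component n X r s \<in> root_space n (position_weight n r s)"
  unfolding root_space_iff
proof (intro conjI ballI allI impI root_component_pe[OF X rs])
  fix h a b assume h: "h \<in> cartan n" and ab: "a < n + n" "b < n + n"
    and "root_component n X r s $$ (a, b) \<noteq> 0"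
  then have "a = r \<and> b = s \<or> a = swap_half n s \<and> b = swap_half n r"
    by (auto simp: root_component_def split: if_splits)
  then show "h $$ (a, a) - h $$ (b, b) = position_weight n r s h"
    using h rs by (auto simp: position_weight_cartan cartan_swap)
qed

text \<open>Root components are subtracted one at a time, until only diagonal entries are left.\<close>

lemma pe_subset_root_span:
  "X \<in> pe n \<Longrightarrow> X \<in> mat_span n (cartan n \<union> (\<Union>\<alpha>\<in>roots n. root_space n \<alpha>))" (is "_ \<Longrightarrow> _ \<in> ?M")
proof (induction "card {(r, s). r < n + n \<and> s < n + n \<and> r \<noteq> s \<and> X $$ (r, s) \<noteq> 0}" arbitrary: X rule: less_induct)
  case less
  let ?S = "\<lambda>X. {(r, s). r < n + n \<and> s < n + n \<and> r \<noteq> s \<and> X $$ (r, s) \<noteq> (0::complex)}"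
  show ?case
  proof (cases "X \<in> cartan n")
    case True
    then show ?thesis by (intro mat_span.gen) blast
  next
    case False
    then obtain r s where rs: "r < n + n" "s < n + n" "r \<noteq> s" "X $$ (r, s) \<noteq> 0"
      using less.prems by (auto simp: cartan_iff)
    let ?C = "root_component n X r s"
    let ?X = "X + (- 1) \<cdot>\<^sub>m ?C"
    have X: "X \<in> carrier_mat (n + n) (n + n)" using less.prems by (rule pe_carrier)
    have C: "?C \<in> carrier_mat (n + n) (n + n)" by (simp add: root_component_def)
    have "?S ?X \<subset> ?S X"
    proof (rule psubsetI)
      show "?S ?X \<subseteq> ?S X" using X C by (auto simp: root_component_def split: if_splits)
      have "(r, s) \<in> ?S X" "(r, s) \<notin> ?S ?X" using rs X C by (auto simp: root_component_def)
      then show "?S ?X \<noteq> ?S X" by blast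
    qed
    moreover have "finite (?S X)"
      by (rule finite_subset[of _ "{..<n+n} \<times> {..<n+n}"]) auto
    ultimately have "card (?S ?X) < card (?S X)" by (rule psubset_card_mono[rotated])
    moreover have C_pe: "?C \<in> pe n" using less.prems rs by (intro root_component_pe)
    then have "?X \<in> pe n" using less.prems by (intro pe_add pe_smult)
    ultimately have "?X \<in> ?M" by (intro less.hyps)
    moreover have "?C \<in> ?M"
    proof (rule mat_span.gen)
      have "position_weight n r s \<in> roots n" using position_weight_root less.prems rs by blast
      then show "?C \<in> cartan n \<union> (\<Union>\<alpha>\<in>roots n. root_space n \<alpha>)"
        using root_component_root_space[OF less.prems rs(1,2)] by blast
    qed
    ultimately have "?X + ?C \<in> ?M" by (rule mat_span.add)
    moreover have "?X + ?C = X" using X C by (intro eq_matI) auto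
    ultimately show ?thesis by simp
  qed
qed

definition plus_vector :: "nat \<Rightarrow> nat \<Rightarrow> nat \<Rightarrow> complex mat" where
  "plus_vector n i j = mat (n + n) (n + n) (\<lambda>(r, s). if r = i \<and> s = n + j \<or> r = j \<and> s = n + i then 1 else 0)"

definition minus_vector :: "nat \<Rightarrow> nat \<Rightarrow> nat \<Rightarrow> complex mat" where
  "minus_vector n i j = mat (n + n) (n + n) (\<lambda>(r, s). if r = n + i \<and> s = j then 1 else if r = n + j \<and> s = i then - 1 else 0)"

lemma plus_vector_pe:
  assumes "i < n" "j < n" shows "plus_vector n i j \<in> pe n"
proof (rule peI)
  fix r s assume rs: "r < n + n" "s < n + n"
  have "swap_half n s = i \<and> swap_half n r = n + j \<or> swap_half n s = j \<and> swap_half n r = n + i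
      \<longleftrightarrow> r = i \<and> s = n + j \<or> r = j \<and> s = n + i"
    using assms rs by (cases "r < n"; cases "s < n") (auto simp: swap_half_def)
  moreover have "transpose_sign n r s = 1" if "r = i \<and> s = n + j \<or> r = j \<and> s = n + i"
    using that assms by (auto simp: transpose_sign_def)
  ultimately show "plus_vector n i j $$ (swap_half n s, swap_half n r) = transpose_sign n r s * plus_vector n i j $$ (r, s)"
    using rs by (simp add: plus_vector_def swap_half_less)
qed (simp add: plus_vector_def)

lemma minus_vector_pe:
  assumes "i < j" "j < n" shows "minus_vector n i j \<in> pe n"
proof (rule peI)
  fix r s assume rs: "r < n + n" "s < n + n"
  have "swap_half n s = n + i \<and> swap_half n r = j \<longleftrightarrow> r = n + j \<and> s = i"
    "swap_half n s = n + j \<and> swap_half n r = i \<longleftrightarrow> r = n + i \<and> s = j"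
    using assms rs by (cases "r < n"; cases "s < n"; auto simp: swap_half_def)+
  moreover have "transpose_sign n r s = - 1" if "r = n + i \<and> s = j \<or> r = n + j \<and> s = i"
    using that assms by (auto simp: transpose_sign_def)
  ultimately show "minus_vector n i j $$ (swap_half n s, swap_half n r) = transpose_sign n r s * minus_vector n i j $$ (r, s)"
    using rs assms by (auto simp: minus_vector_def swap_half_less)
qed (simp add: minus_vector_def)

lemma plus_vector_root:
  assumes "i < n" "j < n" shows "plus_vector n i j \<in> root_space n (wt_add (eps i) (eps j))"
  unfolding root_space_iff
proof (intro conjI ballI allI impI plus_vector_pe assms)
  fix h r s assume h: "h \<in> cartan n" and rs: "r < n + n" "s < n + n" "plus_vector n i j $$ (r, s) \<noteq> 0"
  then have "r = i \<and> s = n + j \<or> r = j \<and> s = n + i" by (auto simp: plus_vector_def split: if_splits)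
  then show "h $$ (r, r) - h $$ (s, s) = wt_add (eps i) (eps j) h"
    using h assms by (auto simp: cartan_diag wt_add_def eps_def)
qed

lemma minus_vector_root:
  assumes "i < j" "j < n" shows "minus_vector n i j \<in> root_space n (wt_neg (wt_add (eps i) (eps j)))"
  unfolding root_space_iff
proof (intro conjI ballI allI impI minus_vector_pe assms)
  fix h r s assume h: "h \<in> cartan n" and rs: "r < n + n" "s < n + n" "minus_vector n i j $$ (r, s) \<noteq> 0"
  then have "r = n + i \<and> s = j \<or> r = n + j \<and> s = i" by (auto simp: minus_vector_def split: if_splits)
  then show "h $$ (r, r) - h $$ (s, s) = wt_neg (wt_add (eps i) (eps j)) h"
    using h assms by (auto simp: cartan_diag wt_add_def wt_neg_def eps_def)
qed

lemma root_space_plus_eq: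
  assumes x: "x \<in> root_space n (wt_add (eps i) (eps j))" and ij: "i \<le> j" "j < n"
  shows "x = (x $$ (i, n + j)) \<cdot>\<^sub>m plus_vector n i j"
proof (rule eq_matI)
  fix r s assume "r < dim_row (x $$ (i, n + j) \<cdot>\<^sub>m plus_vector n i j)" "s < dim_col (x $$ (i, n + j) \<cdot>\<^sub>m plus_vector n i j)"
  then have rs: "r < n + n" "s < n + n" by (auto simp: plus_vector_def)
  have "x $$ (j, n + i) = x $$ (i, n + j)"
    using pe_swap[OF root_space_subset_pe[OF x], of i "n + j"] ij
    by (simp add: swap_half_def transpose_sign_def add.commute)
  then show "x $$ (r, s) = (x $$ (i, n + j) \<cdot>\<^sub>m plus_vector n i j) $$ (r, s)"
    using support_plus[OF x ij rs] rs by (auto simp: plus_vector_def)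
qed (use pe_carrier[OF root_space_subset_pe[OF x]] in \<open>auto simp: plus_vector_def\<close>)

lemma root_space_minus_eq:
  assumes x: "x \<in> root_space n (wt_neg (wt_add (eps i) (eps j)))" and ij: "i < j" "j < n"
  shows "x = (x $$ (n + i, j)) \<cdot>\<^sub>m minus_vector n i j"
proof (rule eq_matI)
  fix r s assume "r < dim_row (x $$ (n + i, j) \<cdot>\<^sub>m minus_vector n i j)" "s < dim_col (x $$ (n + i, j) \<cdot>\<^sub>m minus_vector n i j)"
  then have rs: "r < n + n" "s < n + n" by (auto simp: minus_vector_def)
  have "x $$ (n + j, i) = - x $$ (n + i, j)"
    using pe_swap[OF root_space_subset_pe[OF x], of "n + i" j] ij
    by (simp add: swap_half_def transpose_sign_def add.commute)
  then show "x $$ (r, s) = (x $$ (n + i, j) \<cdot>\<^sub>m minus_vector n i j) $$ (r, s)"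
    using support_minus[OF x ij rs] rs ij by (auto simp: minus_vector_def)
qed (use pe_carrier[OF root_space_subset_pe[OF x]] in \<open>auto simp: minus_vector_def\<close>)

lemma sbracket_minus_plus:
  assumes ij: "i < j" "j < n"
  shows "sbracket n (minus_vector n i j) (plus_vector n i j) = cartan_basis n j + (- 1) \<cdot>\<^sub>m cartan_basis n i"
proof (rule eq_matI)
  fix r s assume "r < dim_row (cartan_basis n j + (- 1) \<cdot>\<^sub>m cartan_basis n i)"
    "s < dim_col (cartan_basis n j + (- 1) \<cdot>\<^sub>m cartan_basis n i)"
  then have rs: "r < n + n" "s < n + n" by (auto simp: cartan_basis_def)
  let ?e = "minus_vector n i j" and ?f = "plus_vector n i j"
  let ?g = "\<lambda>t. ?e $$ (r, t) * ?f $$ (t, s) - koszul_sign n r t s * (?f $$ (r, t) * ?e $$ (t, s))"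
  have "sbracket n ?e ?f $$ (r, s) = (\<Sum>t<n+n. ?g t)" using rs by (rule sbracket_index)
  also have "\<dots> = (\<Sum>t\<in>{i, j, n + i, n + j}. ?g t)"
    by (rule sum.mono_neutral_right) (use rs ij in \<open>auto simp: minus_vector_def plus_vector_def\<close>)
  also have "\<dots> = ?g i + ?g j + ?g (n + i) + ?g (n + j)"
    using ij by (simp add: add.assoc)
  also have "\<dots> = (cartan_basis n j + (- 1) \<cdot>\<^sub>m cartan_basis n i) $$ (r, s)"
    using rs ij by (simp add: minus_vector_def plus_vector_def koszul_sign_def cartan_basis_def)
  finally show "sbracket n ?e ?f $$ (r, s) = (cartan_basis n j + (- 1) \<cdot>\<^sub>m cartan_basis n i) $$ (r, s)" .
qed (auto simp: cartan_basis_def)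

lemma root_space_subset_chain_borel:
  assumes "\<alpha> \<in> borel_roots n p" shows "root_space n \<alpha> \<subseteq> chain_borel n p"
proof
  fix x assume "x \<in> root_space n \<alpha>"
  then show "x \<in> chain_borel n p"
    unfolding chain_borel_def borel_of_def borel_roots_def[symmetric]
    using assms by (blast intro: mat_span.gen)
qed

lemma root_in_chain_borel:
  assumes "\<alpha> \<in> roots n" "x \<in> root_space n \<alpha>" "x \<in> chain_borel n p" "x \<noteq> 0\<^sub>m (n + n) (n + n)"
  shows "\<alpha> \<in> borel_roots n p"
  using root_in_borel_of[of \<alpha> n "chain_odd_roots n p" x] borel_roots_subset_roots[of n p] assms
  by (simp add: borel_roots_def chain_borel_def)

text \<open>For \<open>i < j\<close> the root vectors of \<open>-\<gamma>\<close> lie only in the first Borel subalgebra, those of \<open>\<gamma>\<close> only in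
  the second, so neither of the two contains the other.\<close>

lemma not_connected_by_inclusion:
  assumes p: "p < length (gamma_seq n)" and \<gamma>: "gamma_seq n ! p = wt_add (eps i) (eps j)" and ij: "i < j" "j < n"
  shows "\<not> connected_by_inclusion n (chain_borel n p) (chain_borel n (Suc p))"
proof -
  let ?e = "minus_vector n i j" and ?f = "plus_vector n i j"
  have ind: "gamma_indices n ! p = (i, j)"
    using gamma_seq_nth_indices[OF p \<gamma>] ij by simp
  have i: "i < n" "i \<le> j" using ij by simp_all
  have e: "?e \<in> root_space n (wt_neg (wt_add (eps i) (eps j)))" by (rule minus_vector_root[OF ij])
  have f: "?f \<in> root_space n (wt_add (eps i) (eps j))" by (rule plus_vector_root[OF i(1) ij(2)])
  have nz: "?e \<noteq> 0\<^sub>m (n + n) (n + n)" "?f \<noteq> 0\<^sub>m (n + n) (n + n)"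
  proof -
    have "?e $$ (n + i, j) = 1" "?f $$ (i, n + j) = 1"
      using ij by (simp_all add: minus_vector_def plus_vector_def)
    moreover have "(0\<^sub>m (n + n) (n + n) :: complex mat) $$ (n + i, j) = 0"
      "(0\<^sub>m (n + n) (n + n) :: complex mat) $$ (i, n + j) = 0"
      using ij by simp_all
    ultimately show "?e \<noteq> 0\<^sub>m (n + n) (n + n)" "?f \<noteq> 0\<^sub>m (n + n) (n + n)"
      by (metis zero_neq_one)+
  qed
  have "wt_neg (wt_add (eps i) (eps j)) \<in> borel_roots n p"
    using chain_odd_roots_minusI[OF p ind ij] by (simp add: borel_roots_def index_before_def)
  then have e_in: "?e \<in> chain_borel n p"
    using root_space_subset_chain_borel e by blast
  have "wt_neg (wt_add (eps i) (eps j)) \<notin> borel_roots n (Suc p)"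
    using borel_roots_Suc[OF p, of "wt_neg (wt_add (eps i) (eps j))"] \<gamma>
      root_kinds_distinct(3)[OF i(1) ij(2) i(1) ij(2)] by auto
  then have e_out: "?e \<notin> chain_borel n (Suc p)"
    using root_in_chain_borel[OF wt_neg_root[OF ij] e _ nz(1)] by blast
  have "wt_add (eps i) (eps j) \<in> borel_roots n (Suc p)"
    using chain_odd_roots_earlier[of p "Suc p" n] p \<gamma> by (simp add: borel_roots_def)
  then have f_in: "?f \<in> chain_borel n (Suc p)"
    using root_space_subset_chain_borel f by blast
  have "wt_add (eps i) (eps j) \<notin> borel_roots n p"
  proof
    assume "wt_add (eps i) (eps j) \<in> borel_roots n p"
    then show False using p ind
    proof (cases rule: borel_roots_cases)
      case (even a b)
      then show False using root_kinds_distinct(1)[of a n b i j] i ij by simp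
    next
      case (plus a b)
      then have "i = a \<and> j = b"
        using wt_add_eps_inject[OF fun_cong[OF plus(4)] i(2) ij(2) plus(1,2)] by simp
      then show False using plus(3) by (simp add: index_before_def)
    next
      case (minus a b)
      then show False using root_kinds_distinct(3)[of i n j a b] i ij by simp
    qed
  qed
  then have f_out: "?f \<notin> chain_borel n p"
    using root_in_chain_borel[OF wt_add_root[OF i(2) ij(2)] f _ nz(2)] by blast
  show ?thesis
    using e_in e_out f_in f_out unfolding connected_by_inclusion_def codim_one_subalgebra_def by blast
qed

lemma wt_form_diff:
  assumes "i < n" "j < n"
  shows "wt_form n (wt_component n lam m) (wt_diff (eps i) (eps j)) =
    lam (tens n (cartan_basis n i) m) - lam (tens n (cartan_basis n j) m)"
proof -
  have "wt_form n (wt_component n lam m) (wt_diff (eps i) (eps j)) =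
      (\<Sum>a<n. (if a = i then lam (tens n (cartan_basis n a) m) else 0) - (if a = j then lam (tens n (cartan_basis n a) m) else 0))"
    unfolding wt_form_def using assms
    by (intro sum.cong) (auto simp: wt_component_def wt_diff_def eps_cartan_basis)
  also have "\<dots> = lam (tens n (cartan_basis n i) m) - lam (tens n (cartan_basis n j) m)"
    using assms by (simp add: sum_subtractf)
  finally show ?thesis .
qed

section \<open>The action of a Takiff superalgebra\<close>

lemma sbracket_zero:
  "sbracket n (0\<^sub>m (n + n) (n + n)) y = 0\<^sub>m (n + n) (n + n)"
  "sbracket n x (0\<^sub>m (n + n) (n + n)) = 0\<^sub>m (n + n) (n + n)"
  by (rule eq_matI; simp add: sbracket_index)+

lemma tens_zero: "tens n (0\<^sub>m (n + n) (n + n)) i = (\<lambda>_. 0\<^sub>m (n + n) (n + n))"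
  by (auto simp: tens_def)

lemma tens_in_takiff: "x \<in> S \<Longrightarrow> 0\<^sub>m (n + n) (n + n) \<in> S \<Longrightarrow> i \<le> l \<Longrightarrow> tens n x i \<in> takiff n l S"
  by (auto simp: takiff_def tens_def)

lemma takiff_mono: "S \<subseteq> T \<Longrightarrow> takiff n l S \<subseteq> takiff n l T"
  by (auto simp: takiff_def)

lemma pe_part_subset: "pe_part n d \<subseteq> pe n"
  by (auto simp: pe_part_def)

lemma pe_part_zero: "0\<^sub>m (n + n) (n + n) \<in> pe_part n d"
  by (rule pe_partI) (simp_all add: pe_zero)

lemma cartan_zero: "0\<^sub>m (n + n) (n + n) \<in> cartan n"
  by (simp add: cartan_iff pe_zero)

lemma tbracket_tens:
  assumes "i \<le> l" "j \<le> l"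
  shows "tbracket n l (tens n x i) (tens n y j) =
    (if i + j \<le> l then tens n (sbracket n x y) (i + j) else (\<lambda>_. 0\<^sub>m (n + n) (n + n)))"
proof
  fix k
  show "tbracket n l (tens n x i) (tens n y j) k =
    (if i + j \<le> l then tens n (sbracket n x y) (i + j) else (\<lambda>_. 0\<^sub>m (n + n) (n + n))) k"
  proof (cases "k \<le> l")
    case False
    then show ?thesis by (simp add: tbracket_def tens_def)
  next
    case True
    have "(\<Sum>i'\<le>k. sbracket n (tens n x i i') (tens n y j (k - i')) $$ (a, b)) =
        (if k = i + j then sbracket n x y $$ (a, b) else 0)" if ab: "a < n + n" "b < n + n" for a b
    proof -
      have "(\<Sum>i'\<le>k. sbracket n (tens n x i i') (tens n y j (k - i')) $$ (a, b)) =
          (\<Sum>i'\<le>k. if i' = i then if k = i + j then sbracket n x y $$ (a, b) else 0 else 0)"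
        by (rule sum.cong) (use ab in \<open>auto simp: tens_def sbracket_zero\<close>)
      also have "\<dots> = (if k = i + j then sbracket n x y $$ (a, b) else 0)" by simp
      finally show ?thesis .
    qed
    moreover have "(if i + j \<le> l then tens n (sbracket n x y) (i + j) else (\<lambda>_. 0\<^sub>m (n + n) (n + n))) k =
        (if k = i + j then sbracket n x y else 0\<^sub>m (n + n) (n + n))"
      using True by (auto simp: tens_def)
    ultimately show ?thesis using True
      by (intro eq_matI) (simp_all add: tbracket_def split: if_splits)
  qed
qed

lemma tbracket_cartan_root:
  assumes h: "h \<in> takiff n l (cartan n)" and f: "f \<in> root_space n \<gamma>" and m: "m \<le> l"
  shows "tbracket n l h (tens n f m) =
    (\<lambda>k. if m \<le> k \<and> k \<le> l then \<gamma> (h (k - m)) \<cdot>\<^sub>m f else 0\<^sub>m (n + n) (n + n))"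
proof
  fix k
  have f_carr: "f \<in> carrier_mat (n + n) (n + n)"
    using pe_carrier[OF root_space_subset_pe[OF f]] .
  show "tbracket n l h (tens n f m) k =
    (if m \<le> k \<and> k \<le> l then \<gamma> (h (k - m)) \<cdot>\<^sub>m f else 0\<^sub>m (n + n) (n + n))"
  proof (cases "k \<le> l")
    case False
    then show ?thesis by (simp add: tbracket_def)
  next
    case True
    have "(\<Sum>i'\<le>k. sbracket n (h i') (tens n f m (k - i')) $$ (a, b)) =
        (if m \<le> k then \<gamma> (h (k - m)) * f $$ (a, b) else 0)" if ab: "a < n + n" "b < n + n" for a b
    proof -
      have "sbracket n (h i') f = \<gamma> (h i') \<cdot>\<^sub>m f" if "i' \<le> k" for i'
        using f h that True by (auto simp: root_space_def takiff_def)
      then have "(\<Sum>i'\<le>k. sbracket n (h i') (tens n f m (k - i')) $$ (a, b)) =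
          (\<Sum>i'\<le>k. if i' = k - m then if m \<le> k then \<gamma> (h (k - m)) * f $$ (a, b) else 0 else 0)"
        by (intro sum.cong) (use ab f_carr in \<open>auto simp: tens_def sbracket_zero\<close>)
      also have "\<dots> = (if m \<le> k then \<gamma> (h (k - m)) * f $$ (a, b) else 0)" by simp
      finally show ?thesis .
    qed
    then show ?thesis using True f_carr
      by (intro eq_matI) (simp_all add: tbracket_def split: if_splits)
  qed
qed

context takiff_pe_module
begin

lemma act_zero_vector: "x \<in> takiff n l (pe n) \<Longrightarrow> act x 0 = 0"
  using act_scale[of x 0 0] by simp

lemma act_minus_vector: "x \<in> takiff n l (pe n) \<Longrightarrow> act x (v - w) = act x v - act x w"
  using act_add[of x "v - w" w] by (simp add: algebra_simps)

lemma tens_pe: "x \<in> pe n \<Longrightarrow> i \<le> l \<Longrightarrow> tens n x i \<in> takiff n l (pe n)"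
  by (intro tens_in_takiff pe_zero)

lemma act_tens_add:
  assumes "x \<in> pe n" "y \<in> pe n" "i \<le> l"
  shows "act (tens n (x + y) i) v = act (tens n x i) v + act (tens n y i) v"
proof -
  have "tens n (x + y) i = tadd (tens n x i) (tens n y i)"
    by (auto simp: tens_def tadd_def)
  then show ?thesis using assms by (simp add: act_tadd tens_pe)
qed

lemma act_tens_smult:
  assumes "x \<in> pe n" "i \<le> l"
  shows "act (tens n (c \<cdot>\<^sub>m x) i) v = scale c (act (tens n x i) v)"
proof -
  have "tens n (c \<cdot>\<^sub>m x) i = tsmult c (tens n x i)"
    by (auto simp: tens_def tsmult_def)
  then show ?thesis using assms by (simp add: act_tsmult tens_pe)
qed

lemma act_zero_element: "act (\<lambda>_. 0\<^sub>m (n + n) (n + n)) v = 0"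
proof -
  let ?z = "\<lambda>_. 0\<^sub>m (n + n) (n + n)"
  have z: "?z \<in> takiff n l (pe n)" by (simp add: takiff_def pe_zero)
  have "tsmult 0 ?z = (?z :: tmat)" by (auto simp: tsmult_def)
  then show ?thesis using act_tsmult[OF z, of 0 v] by simp
qed

lemma act_tens_zero: "act (tens n (0\<^sub>m (n + n) (n + n)) i) v = 0"
  by (simp add: tens_zero act_zero_element)

lemma act_expand:
  assumes x: "x \<in> takiff n l (pe n)"
  shows "act x v = (\<Sum>k\<le>l. act (tens n (x k) k) v)"
proof -
  define trunc where "trunc m = (\<lambda>k. if k < m then x k else 0\<^sub>m (n + n) (n + n))" for m
  have carr: "x k \<in> carrier_mat (n + n) (n + n)" for k
    using x pe_carrier by (cases "k \<le> l") (auto simp: takiff_def)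
  have trunc: "trunc m \<in> takiff n l (pe n)" for m
    using x by (auto simp: takiff_def trunc_def pe_zero)
  have "act (trunc m) v = (\<Sum>k<m. act (tens n (x k) k) v)" if "m \<le> Suc l" for m
    using that
  proof (induction m)
    case 0
    have "trunc 0 = (\<lambda>_. 0\<^sub>m (n + n) (n + n))" by (simp add: trunc_def)
    then show ?case by (simp add: act_zero_element)
  next
    case (Suc m)
    have "trunc (Suc m) = tadd (trunc m) (tens n (x m) m)"
      using carr by (auto simp: trunc_def tadd_def tens_def less_Suc_eq)
    moreover have "tens n (x m) m \<in> takiff n l (pe n)"
      using x Suc.prems by (intro tens_pe) (auto simp: takiff_def)
    ultimately show ?case using Suc trunc by (simp add: act_tadd)
  qed
  moreover have "trunc (Suc l) = x" using x by (auto simp: trunc_def takiff_def)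
  ultimately show ?thesis by (metis lessThan_Suc_atMost order_refl)
qed

lemma act_tens_commute:
  assumes "x \<in> pe_part n d" "y \<in> pe_part n e" "i \<le> l" "j \<le> l"
  shows "act (tens n x i) (act (tens n y j) v) =
    (if i + j \<le> l then act (tens n (sbracket n x y) (i + j)) v else 0)
      + scale (if d \<and> e then - 1 else 1) (act (tens n y j) (act (tens n x i) v))"
proof -
  have "act (tbracket n l (tens n x i) (tens n y j)) v =
      act (tens n x i) (act (tens n y j) v)
        - scale (if d \<and> e then - 1 else 1) (act (tens n y j) (act (tens n x i) v))"
    using assms by (intro act_bracket tens_in_takiff pe_part_zero)
  moreover have "act (tbracket n l (tens n x i) (tens n y j)) v =
      (if i + j \<le> l then act (tens n (sbracket n x y) (i + j)) v else 0)"
    using assms by (simp add: tbracket_tens act_zero_element)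
  ultimately show ?thesis by (simp add: algebra_simps)
qed

text \<open>The coefficients of \<open>h\<close> of positive degree move \<open>f\<close> to higher degrees, where it is assumed to kill
  \<open>z\<close>; so only the constant coefficient contributes.\<close>

lemma act_cartan_commute:
  assumes h: "h \<in> takiff n l (cartan n)" and f: "f \<in> root_space n \<gamma>" "f \<in> pe_part n d" and m: "m \<le> l"
    and vanish: "\<And>m'. m < m' \<Longrightarrow> m' \<le> l \<Longrightarrow> act (tens n f m') z = 0"
  shows "act h (act (tens n f m) z) = act (tens n f m) (act h z) + scale (\<gamma> (h 0)) (act (tens n f m) z)"
proof -
  let ?b = "tbracket n l h (tens n f m)"
  have fpe: "f \<in> pe n" using f(1) by (rule root_space_subset_pe)
  note b = tbracket_cartan_root[OF h f(1) m]
  have "h \<in> takiff n l (pe_part n False)"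
    using h takiff_mono[of "cartan n" "pe_part n False"] cartan_even by blast
  then have br: "act ?b z = act h (act (tens n f m) z) - act (tens n f m) (act h z)"
    using act_bracket[of h False "tens n f m" d z] f(2) m by (simp add: tens_in_takiff pe_part_zero)
  have "?b \<in> takiff n l (pe n)"
    using fpe by (auto simp: b takiff_def pe_zero intro: pe_smult)
  then have "act ?b z = (\<Sum>k\<le>l. act (tens n (?b k) k) z)" by (rule act_expand)
  also have "\<dots> = (\<Sum>k\<le>l. if k = m then scale (\<gamma> (h 0)) (act (tens n f m) z) else 0)"
  proof (rule sum.cong)
    fix k assume "k \<in> {..l}"
    then show "act (tens n (?b k) k) z = (if k = m then scale (\<gamma> (h 0)) (act (tens n f m) z) else 0)"
      using fpe vanish[of k] by (cases k m rule: linorder_cases) (auto simp: b act_tens_zero act_tens_smult)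
  qed simp
  also have "\<dots> = scale (\<gamma> (h 0)) (act (tens n f m) z)" using m by simp
  finally show ?thesis using br by (simp add: algebra_simps)
qed

section \<open>Submodules generated by lowering operators\<close>

text \<open>With \<open>N\<close> the set of roots outside a Borel subalgebra, this is the span of all products of
  lowering operators applied to \<open>u\<close>.\<close>

inductive_set lowering_span :: "weight set \<Rightarrow> 'v \<Rightarrow> 'v set" for N u where
  base: "u \<in> lowering_span N u"
| zero: "0 \<in> lowering_span N u"
| add: "z \<in> lowering_span N u \<Longrightarrow> w \<in> lowering_span N u \<Longrightarrow> z + w \<in> lowering_span N u"
| scale: "z \<in> lowering_span N u \<Longrightarrow> scale c z \<in> lowering_span N u"
| act: "\<alpha> \<in> N \<Longrightarrow> y \<in> root_space n \<alpha> \<Longrightarrow> i \<le> l \<Longrightarrow> z \<in> lowering_span N u \<Longrightarrow>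
    act (tens n y i) z \<in> lowering_span N u"

lemma subspace_lowering_span: "subspace (lowering_span N u)"
  by (auto simp: subspace_def intro: lowering_span.intros)

lemma act_in_subspace:
  assumes W: "subspace W"
    and gen: "\<And>y i. y \<in> cartan n \<or> (\<exists>\<alpha>\<in>roots n. y \<in> root_space n \<alpha>) \<Longrightarrow> i \<le> l \<Longrightarrow> act (tens n y i) z \<in> W"
    and x: "x \<in> takiff n l (pe n)"
  shows "act x z \<in> W"
proof -
  have "act (tens n X i) z \<in> W" if "X \<in> pe n" "i \<le> l" for X i
  proof -
    have "X \<in> pe n \<and> act (tens n X i) z \<in> W"
      using pe_subset_root_span[OF that(1)]
    proof induction
      case zero
      show ?case using W by (simp add: pe_zero act_tens_zero subspace_0)
    next
      case (gen X)
      then show ?case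
        using assms(2) that(2) cartan_subset_pe root_space_subset_pe by blast
    next
      case (add X Y)
      then show ?case using W that(2) by (simp add: pe_add act_tens_add subspace_add)
    next
      case (smult X c)
      then show ?case using W that(2) by (simp add: pe_smult act_tens_smult subspace_scale)
    qed
    then show ?thesis by simp
  qed
  then show ?thesis
    using x by (subst act_expand[OF x]) (intro subspace_sum[OF W], auto simp: takiff_def)
qed

text \<open>This replaces the factorisation of the enveloping algebra given by the
  Poincare-Birkhoff-Witt theorem. An operator \<open>x\<close> is commuted past the leftmost lowering
  operator \<open>y\<close>, and both \<open>[x, y]\<close> and \<open>x\<close> then act on a shorter product, to which the induction hypothesis
  applies because it covers all elements of the Takiff superalgebra at once.\<close>

lemma lowering_span_submodule:
  assumes kill: "\<forall>\<alpha>\<in>roots n - N. \<forall>x\<in>root_space n \<alpha>. \<forall>i\<le>l. act (tens n x i) u = 0"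
    and cartan: "\<forall>h\<in>cartan n. \<forall>i\<le>l. \<exists>c. act (tens n h i) u = scale c u"
    and N: "N \<subseteq> roots n"
    and z: "z \<in> lowering_span N u" and x: "x \<in> takiff n l (pe n)"
  shows "act x z \<in> lowering_span N u"
  using z x
proof (induction arbitrary: x)
  case base
  show ?case
  proof (rule act_in_subspace[OF subspace_lowering_span _ base])
    fix y i assume y: "y \<in> cartan n \<or> (\<exists>\<alpha>\<in>roots n. y \<in> root_space n \<alpha>)" and i: "i \<le> l"
    from y consider "y \<in> cartan n" | \<alpha> where "\<alpha> \<in> N" "y \<in> root_space n \<alpha>"
      | \<alpha> where "\<alpha> \<in> roots n" "\<alpha> \<notin> N" "y \<in> root_space n \<alpha>" by blast
    then show "act (tens n y i) u \<in> lowering_span N u"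
    proof cases
      case 1
      then obtain c where "act (tens n y i) u = scale c u" using cartan i by blast
      then show ?thesis using lowering_span.base lowering_span.scale by simp
    next
      case 2
      then show ?thesis using i lowering_span.base by (intro lowering_span.act)
    next
      case 3
      then show ?thesis using kill i lowering_span.zero by simp
    qed
  qed
next
  case zero
  then show ?case using lowering_span.zero by (simp add: act_zero_vector)
next
  case (add z w)
  then show ?case using lowering_span.add by (simp add: act_add)
next
  case (scale z c)
  then show ?case using lowering_span.scale by (simp add: act_scale)
next
  case (act \<alpha> y i z)
  obtain e where e: "y \<in> pe_part n e"
    using root_space_homogeneous act.hyps(1,2) N by blast
  show ?case
  proof (rule act_in_subspace[OF subspace_lowering_span _ act.prems])
    fix x j assume x: "x \<in> cartan n \<or> (\<exists>\<alpha>\<in>roots n. x \<in> root_space n \<alpha>)" and j: "j \<le> l"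
    then obtain d where d: "x \<in> pe_part n d"
      using root_space_homogeneous cartan_even by blast
    have pe: "x \<in> pe n" "y \<in> pe n" using d e pe_part_subset by blast+
    have "j + i \<le> l \<Longrightarrow> act (tens n (sbracket n x y) (j + i)) z \<in> lowering_span N u"
      using pe by (intro act.IH tens_pe pe_sbracket)
    moreover have "act (tens n y i) (act (tens n x j) z) \<in> lowering_span N u"
      using act.hyps j pe by (intro lowering_span.act[of \<alpha>] act.IH tens_pe)
    ultimately show "act (tens n x j) (act (tens n y i) z) \<in> lowering_span N u"
      using lowering_span.zero
      by (subst act_tens_commute[OF d e j act.hyps(3)]) (auto intro!: subspace_add[OF subspace_lowering_span] subspace_scale[OF subspace_lowering_span] subspace_neg[OF subspace_lowering_span] subspace_diff[OF subspace_lowering_span])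
  qed
qed

lemma grading_zero: "0 \<in> V d"
  using grading_subspace by (rule subspace_0)

text \<open>Simplicity concerns graded submodules, so the generating vector has to be homogeneous.\<close>

lemma lowering_span_graded:
  assumes N: "N \<subseteq> roots n" and u: "u \<in> V d"
  shows "graded_subset V (lowering_span N u)"
  unfolding graded_subset_def
proof
  fix z assume "z \<in> lowering_span N u"
  then show "\<exists>w0\<in>lowering_span N u \<inter> V False. \<exists>w1\<in>lowering_span N u \<inter> V True. z = w0 + w1"
  proof induction
    case base
    show ?case
    proof (cases d)
      case True
      then show ?thesis using u lowering_span.base lowering_span.zero grading_zero
        by (intro bexI[of _ 0] bexI[of _ u]) auto
    next
      case False
      then show ?thesis using u lowering_span.base lowering_span.zero grading_zero
        by (intro bexI[of _ u] bexI[of _ 0]) auto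
    qed
  next
    case zero
    show ?case using lowering_span.zero grading_zero by (intro bexI[of _ 0]) auto
  next
    case (add z w)
    then obtain z0 z1 w0 w1 where "z0 \<in> lowering_span N u \<inter> V False" "z1 \<in> lowering_span N u \<inter> V True" "z = z0 + z1"
      "w0 \<in> lowering_span N u \<inter> V False" "w1 \<in> lowering_span N u \<inter> V True" "w = w0 + w1" by blast
    then show ?case
      by (intro bexI[of _ "z0 + w0"] bexI[of _ "z1 + w1"])
        (auto intro: lowering_span.add subspace_add[OF grading_subspace])
  next
    case (scale z c)
    then obtain z0 z1 where "z0 \<in> lowering_span N u \<inter> V False" "z1 \<in> lowering_span N u \<inter> V True" "z = z0 + z1" by blast
    then show ?case
      by (intro bexI[of _ "scale c z0"] bexI[of _ "scale c z1"])
        (auto intro: lowering_span.scale subspace_scale[OF grading_subspace] simp: scale_right_distrib)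
  next
    case (act \<alpha> y i z)
    then obtain z0 z1 where z: "z0 \<in> lowering_span N u \<inter> V False" "z1 \<in> lowering_span N u \<inter> V True" "z = z0 + z1" by blast
    obtain e where e: "y \<in> pe_part n e"
      using root_space_homogeneous act.hyps(1,2) N by blast
    let ?y = "act (tens n y i)"
    have y: "tens n y i \<in> takiff n l (pe_part n e)" "tens n y i \<in> takiff n l (pe n)"
      using e act.hyps pe_part_subset by (auto intro!: tens_in_takiff pe_part_zero pe_zero)
    have sum: "?y z = ?y z0 + ?y z1" using y z by (simp add: act_add)
    have mem: "?y z0 \<in> lowering_span N u" "?y z1 \<in> lowering_span N u"
      using z act.hyps by (auto intro: lowering_span.act)
    have deg: "?y z0 \<in> V (e \<noteq> False)" "?y z1 \<in> V (e \<noteq> True)"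
      using act_parity[OF y(1), of z0 False] act_parity[OF y(1), of z1 True] z by simp_all
    show ?case
    proof (cases e)
      case True
      then show ?thesis using sum mem deg
        by (intro bexI[of _ "?y z1"] bexI[of _ "?y z0"]) (auto simp: add.commute)
    next
      case False
      then show ?thesis using sum mem deg
        by (intro bexI[of _ "?y z0"] bexI[of _ "?y z1"]) auto
    qed
  qed
qed

text \<open>The operators \<open>D - a\<close> for varying \<open>a\<close> commute; products of them separate the eigenvalues of \<open>D\<close>.\<close>

definition shifted :: "complex mat \<Rightarrow> complex \<Rightarrow> 'v \<Rightarrow> 'v" where
  "shifted D a z = act (tens n D 0) z - scale a z"

lemma shifted_add: "D \<in> pe n \<Longrightarrow> shifted D a (z + w) = shifted D a z + shifted D a w"
  by (simp add: shifted_def act_add tens_pe scale_right_distrib)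

lemma shifted_scale: "D \<in> pe n \<Longrightarrow> shifted D a (scale c z) = scale c (shifted D a z)"
  by (simp add: shifted_def act_scale tens_pe scale_right_diff_distrib scale_left_commute)

lemma shifted_commute: "D \<in> pe n \<Longrightarrow> shifted D a (shifted D b z) = shifted D b (shifted D a z)"
  by (simp add: shifted_def act_scale act_minus_vector tens_pe scale_right_diff_distrib scale_left_commute)

lemma shifted_zero: "D \<in> pe n \<Longrightarrow> shifted D a 0 = 0"
  by (simp add: shifted_def act_zero_vector tens_pe)

lemma foldr_shifted_add:
  "D \<in> pe n \<Longrightarrow> foldr (shifted D) cs (z + w) = foldr (shifted D) cs z + foldr (shifted D) cs w"
  by (induction cs) (simp_all add: shifted_add)

lemma foldr_shifted_scale:
  "D \<in> pe n \<Longrightarrow> foldr (shifted D) cs (scale c z) = scale c (foldr (shifted D) cs z)"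
  by (induction cs) (simp_all add: shifted_scale)

lemma foldr_shifted_zero: "D \<in> pe n \<Longrightarrow> foldr (shifted D) cs 0 = 0"
  by (induction cs) (simp_all add: shifted_zero)

lemma shifted_foldr_commute:
  "D \<in> pe n \<Longrightarrow> shifted D a (foldr (shifted D) cs z) = foldr (shifted D) cs (shifted D a z)"
  by (induction cs) (simp_all add: shifted_commute[of D a])

lemma foldr_shifted_commute:
  "D \<in> pe n \<Longrightarrow> foldr (shifted D) bs (foldr (shifted D) cs z) = foldr (shifted D) cs (foldr (shifted D) bs z)"
  by (induction bs) (simp_all add: shifted_foldr_commute)

lemma foldr_shifted_eigenvector:
  assumes D: "D \<in> pe n" and w: "act (tens n D 0) w = scale c w"
  shows "foldr (shifted D) cs w = scale (\<Prod>a\<leftarrow>cs. c - a) w"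
  by (induction cs) (simp_all add: shifted_scale[OF D] shifted_def[of D _ w] w scale_left_diff_distrib[symmetric] mult.commute)

lemma shifted_root_vector:
  assumes D: "D \<in> cartan n" and \<alpha>: "\<alpha> \<in> roots n" "y \<in> root_space n \<alpha>" and i: "i \<le> l"
  shows "shifted D (\<alpha> D + a) (act (tens n y i) z) = act (tens n y i) (shifted D a z)"
proof -
  obtain e where e: "y \<in> pe_part n e" using root_space_homogeneous \<alpha> by blast
  have y: "y \<in> pe n" using \<alpha> root_space_subset_pe by blast
  have "sbracket n D y = \<alpha> D \<cdot>\<^sub>m y" using D \<alpha>(2) by (simp add: root_space_def)
  then have "act (tens n D 0) (act (tens n y i) z) =
      scale (\<alpha> D) (act (tens n y i) z) + act (tens n y i) (act (tens n D 0) z)"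
    using act_tens_commute[OF cartan_even[OF D] e, of 0 i z] i y by (simp add: act_tens_smult)
  then show ?thesis
    using y i by (simp add: shifted_def act_minus_vector act_scale tens_pe scale_left_distrib)
qed

text \<open>Lowering operators shift eigenvalues of \<open>D\<close> by nonpositive reals. So each vector in the span is a sum of
  eigenvectors with eigenvalues in \<open>c + t\<close>, \<open>t \<le> 0\<close>, which is expressed here by a product of factors \<open>D - (c + t)\<close>
  that annihilates it; this form is easy to carry through the induction.\<close>

lemma lowering_span_annihilated:
  assumes D: "D \<in> cartan n" and N: "N \<subseteq> roots n"
    and low: "\<forall>\<alpha>\<in>N. \<exists>t\<le>0. \<alpha> D = complex_of_real t"
    and u: "act (tens n D 0) u = scale c u"
    and z: "z \<in> lowering_span N u"
  shows "\<exists>ts. (\<forall>t\<in>set ts. t \<le> 0) \<and> foldr (shifted D) (map (\<lambda>t. complex_of_real t + c) ts) z = 0"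
proof -
  have Dpe: "D \<in> pe n" using D by (rule cartan_subset_pe)
  let ?F = "\<lambda>ts. foldr (shifted D) (map (\<lambda>t. complex_of_real t + c) ts)"
  from z show ?thesis
  proof induction
    case base
    have "?F [0] u = 0" by (simp add: shifted_def u)
    then show ?case by (intro exI[of _ "[0]"]) simp
  next
    case zero
    show ?case by (intro exI[of _ "[]"]) simp
  next
    case (add z w)
    then obtain ts ss where t: "\<forall>t\<in>set ts. t \<le> 0" "?F ts z = 0" "\<forall>t\<in>set ss. t \<le> 0" "?F ss w = 0" by blast
    \<comment> \<open>The products for \<open>z\<close> and \<open>w\<close> commute, so their composition annihilates both summands.\<close>
    have "?F (ts @ ss) (z + w) = ?F ss (?F ts z) + ?F ts (?F ss w)"
      by (simp add: foldr_shifted_add[OF Dpe] foldr_shifted_commute[OF Dpe, of "map _ ss"])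
    then show ?case using t by (intro exI[of _ "ts @ ss"]) (auto simp: foldr_shifted_zero[OF Dpe])
  next
    case (scale z c)
    then show ?case by (auto simp: foldr_shifted_scale[OF Dpe])
  next
    case (act \<alpha> y i z)
    then obtain ts where ts: "\<forall>t\<in>set ts. t \<le> 0" "?F ts z = 0" by blast
    obtain s where s: "s \<le> 0" "\<alpha> D = complex_of_real s" using low act.hyps by blast
    \<comment> \<open>Moving the product past a lowering operator shifts all its eigenvalues by \<open>s\<close>.\<close>
    have "?F (map ((+) s) ss) (act (tens n y i) z) = act (tens n y i) (?F ss z)" for ss
    proof (induction ss)
      case (Cons t ss)
      then show ?case
        using shifted_root_vector[OF D _ act.hyps(2,3), of "complex_of_real t + c"] act.hyps(1) N s(2)
        by (auto simp: add.assoc)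
    qed simp
    then have "?F (map ((+) s) ts) (act (tens n y i) z) = 0"
      using ts act.hyps root_space_subset_pe by (simp add: act_zero_vector tens_pe)
    then show ?case using ts s by (intro exI[of _ "map ((+) s) ts"]) auto
  qed
qed

section \<open>Highest weights in a simple module\<close>

text \<open>By simplicity \<open>w\<close> lies in the span of lowering operators on \<open>u\<close>, so a product of factors \<open>D - (c + t)\<close>
  with \<open>t \<le> 0\<close> annihilates it. These factors act on \<open>w\<close> by the nonzero scalars \<open>s - t\<close>.\<close>

lemma no_higher_weight_homogeneous:
  assumes simple: "simple_module scale n l V act"
    and D: "D \<in> cartan n" and N: "N \<subseteq> roots n"
    and low: "\<forall>\<alpha>\<in>N. \<exists>t\<le>0. \<alpha> D = complex_of_real t"
    and kill: "\<forall>\<alpha>\<in>roots n - N. \<forall>x\<in>root_space n \<alpha>. \<forall>i\<le>l. act (tens n x i) u = 0"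
    and cartan: "\<forall>h\<in>cartan n. \<forall>i\<le>l. \<exists>c. act (tens n h i) u = scale c u"
    and u: "u \<in> V d" "u \<noteq> 0" "act (tens n D 0) u = scale c u"
    and w: "act (tens n D 0) w = scale (complex_of_real s + c) w" "s > 0"
  shows "w = 0"
proof -
  have Dpe: "D \<in> pe n" using D by (rule cartan_subset_pe)
  have "submodule scale n l act (lowering_span N u)"
    unfolding submodule_def
    by (intro conjI ballI subspace_lowering_span lowering_span_submodule[OF kill cartan N])
  moreover have "graded_subset V (lowering_span N u)"
    using lowering_span_graded[OF N u(1)] .
  moreover have "lowering_span N u \<noteq> {0}"
    using u(2) lowering_span.base[of u N] by blast
  ultimately have "w \<in> lowering_span N u"
    using simple unfolding simple_module_def by blast
  then obtain ts where ts: "\<forall>t\<in>set ts. t \<le> 0"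
    and z: "foldr (shifted D) (map (\<lambda>t. complex_of_real t + c) ts) w = 0"
    using lowering_span_annihilated[OF D N low u(3), of w] by blast
  have "(\<Prod>a\<leftarrow>map (\<lambda>t. complex_of_real t + c) ts. complex_of_real s + c - a) \<noteq> 0"
    using ts w(2) by (induction ts) (auto simp flip: of_real_diff)
  then show ?thesis
    using z foldr_shifted_eigenvector[OF Dpe w(1)] by simp
qed

lemma graded_components_zero:
  assumes "a0 \<in> V d" "a1 \<in> V (\<not> d)" "a0 + a1 = 0"
  shows "a0 = 0 \<and> a1 = 0"
proof -
  have "a0 = - a1" using assms(3) by (simp add: eq_neg_iff_add_eq_0)
  then have "a0 \<in> V d \<inter> V (\<not> d)" using assms(1,2) subspace_neg[OF grading_subspace] by auto
  then have "a0 = 0" using grading_disjoint by (cases d) auto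
  then show ?thesis using assms(3) by simp
qed

lemma components_killed:
  assumes x: "x \<in> takiff n l (pe_part n e)" and u: "u0 \<in> V False" "u1 \<in> V True"
    and zero: "act x (u0 + u1) = 0"
  shows "act x u0 = 0 \<and> act x u1 = 0"
proof -
  have "act x u0 \<in> V (e \<noteq> False)" "act x u1 \<in> V (e \<noteq> True)"
    using act_parity[OF x, of u0 False] act_parity[OF x, of u1 True] u by simp_all
  moreover have "x \<in> takiff n l (pe n)" using x takiff_mono[OF pe_part_subset] by blast
  then have "act x u0 + act x u1 = 0" using zero by (simp add: act_add)
  ultimately show ?thesis
    using graded_components_zero[of "act x u0" e "act x u1"] by simp
qed

lemma components_eigen:
  assumes h: "h \<in> cartan n" "i \<le> l" and u: "u0 \<in> V False" "u1 \<in> V True"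
    and eq: "act (tens n h i) (u0 + u1) = scale c (u0 + u1)"
  shows "act (tens n h i) u0 = scale c u0 \<and> act (tens n h i) u1 = scale c u1"
proof -
  have hpe: "h \<in> pe n" using h cartan_subset_pe by blast
  have "tens n h i \<in> takiff n l (pe_part n False)"
    using h cartan_even by (intro tens_in_takiff pe_part_zero)
  then have "act (tens n h i) u0 \<in> V False" "act (tens n h i) u1 \<in> V True"
    using act_parity[of "tens n h i" False u0 False] act_parity[of "tens n h i" False u1 True] u by auto
  then have "act (tens n h i) u0 - scale c u0 \<in> V False" "act (tens n h i) u1 - scale c u1 \<in> V (\<not> False)"
    using u by (auto intro!: subspace_diff[OF grading_subspace] subspace_scale[OF grading_subspace])
  moreover have "(act (tens n h i) u0 - scale c u0) + (act (tens n h i) u1 - scale c u1) = 0"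
    using eq hpe h by (simp add: act_add tens_pe scale_right_distrib algebra_simps)
  ultimately have "act (tens n h i) u0 - scale c u0 = 0 \<and> act (tens n h i) u1 - scale c u1 = 0"
    by (rule graded_components_zero)
  then show ?thesis by simp
qed

text \<open>Since the conditions on \<open>u\<close> involve homogeneous elements only, they pass to the even and the odd
  component of \<open>u\<close>.\<close>

lemma no_higher_weight:
  assumes simple: "simple_module scale n l V act"
    and D: "D \<in> cartan n" and N: "N \<subseteq> roots n"
    and low: "\<forall>\<alpha>\<in>N. \<exists>t\<le>0. \<alpha> D = complex_of_real t"
    and kill: "\<forall>\<alpha>\<in>roots n - N. \<forall>x\<in>root_space n \<alpha>. \<forall>i\<le>l. act (tens n x i) u = 0"
    and cartan: "\<forall>h\<in>cartan n. \<forall>i\<le>l. \<exists>c. act (tens n h i) u = scale c u"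
    and u: "act (tens n D 0) u = scale c u"
    and w: "act (tens n D 0) w = scale (complex_of_real s + c) w" "s > 0" "w \<noteq> 0"
  shows "u = 0"
proof -
  obtain u0 u1 where u01: "u0 \<in> V False" "u1 \<in> V True" "u = u0 + u1"
    using grading_sum by blast
  have kill': "act (tens n x i) u0 = 0 \<and> act (tens n x i) u1 = 0"
    if hyp: "\<alpha> \<in> roots n" "\<alpha> \<notin> N" "x \<in> root_space n \<alpha>" "i \<le> l" for \<alpha> x i
  proof -
    obtain e where "x \<in> pe_part n e" using root_space_homogeneous[OF hyp(1,3)] by blast
    then have "tens n x i \<in> takiff n l (pe_part n e)"
      using hyp(4) by (intro tens_in_takiff pe_part_zero)
    moreover have "act (tens n x i) (u0 + u1) = 0"
      using kill hyp u01(3) by blast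
    ultimately show ?thesis
      using components_killed[OF _ u01(1,2)] by blast
  qed
  have cartan': "\<exists>c. act (tens n h i) u0 = scale c u0 \<and> act (tens n h i) u1 = scale c u1"
    if "h \<in> cartan n" "i \<le> l" for h i
    using cartan that components_eigen[OF that u01(1,2)] u01(3) by metis
  have eig: "act (tens n D 0) u0 = scale c u0 \<and> act (tens n D 0) u1 = scale c u1"
    using components_eigen[OF D _ u01(1,2)] u u01(3) by simp
  have "u0 = 0"
  proof (rule ccontr)
    assume "u0 \<noteq> 0"
    have "w = 0"
      by (rule no_higher_weight_homogeneous[OF simple D N low _ _ u01(1) \<open>u0 \<noteq> 0\<close> _ w(1,2)])
        (use kill' cartan' eig in blast)+
    then show False using w(3) by simp
  qed
  moreover have "u1 = 0"
  proof (rule ccontr)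
    assume "u1 \<noteq> 0"
    have "w = 0"
      by (rule no_higher_weight_homogeneous[OF simple D N low _ _ u01(2) \<open>u1 \<noteq> 0\<close> _ w(1,2)])
        (use kill' cartan' eig in blast)+
    then show False using w(3) by simp
  qed
  ultimately show ?thesis using u01(3) by simp
qed

end

section \<open>Odd reflections\<close>

context takiff_pe_module
begin

lemma highest_weight_vectorI:
  assumes "lam \<in> takiff_dual n l" "v \<noteq> 0"
    and kill: "\<forall>\<alpha>\<in>borel_roots n p. \<forall>x\<in>root_space n \<alpha>. \<forall>i\<le>l. act (tens n x i) v = 0"
    and "\<forall>h\<in>takiff n l (cartan n). act h v = scale (lam h) v"
  shows "highest_weight_vector scale n l act (chain_borel n p) lam v"
  unfolding highest_weight_vector_def
proof (intro conjI assms ballI allI impI)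
  fix \<alpha> x i assume *: "\<alpha> \<in> roots n" "x \<in> root_space n \<alpha> \<inter> chain_borel n p" "i \<le> l"
  show "act (tens n x i) v = 0"
  proof (cases "x = 0\<^sub>m (n + n) (n + n)")
    case True
    then show ?thesis by (simp add: act_tens_zero)
  next
    case False
    then show ?thesis using root_in_chain_borel[of \<alpha> n x p] * kill by blast
  qed
qed

lemma highest_weight_vector_killed:
  assumes "highest_weight_vector scale n l act (chain_borel n p) lam v"
  shows "\<forall>\<alpha>\<in>borel_roots n p. \<forall>x\<in>root_space n \<alpha>. \<forall>i\<le>l. act (tens n x i) v = 0"
  using assms root_space_subset_chain_borel borel_roots_subset_roots
  unfolding highest_weight_vector_def by blast

lemma raising_preserves_killed:
  assumes p: "p < length (gamma_seq n)" and f: "f \<in> root_space n (gamma_seq n ! p)" and m: "m \<le> l"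
    and z: "\<forall>\<beta>\<in>borel_roots n p - {wt_neg (gamma_seq n ! p)}. \<forall>x\<in>root_space n \<beta>. \<forall>i\<le>l. act (tens n x i) z = 0"
    and \<alpha>: "\<alpha> \<in> borel_roots n p" "\<alpha> \<noteq> wt_neg (gamma_seq n ! p)" and x: "x \<in> root_space n \<alpha>" and i: "i \<le> l"
  shows "act (tens n x i) (act (tens n f m) z) = 0"
proof -
  obtain a b where ab: "a \<le> b" "b < n" "gamma_seq n ! p = wt_add (eps a) (eps b)"
    using gamma_seq_nth[OF p] by metis
  then have fodd: "f \<in> pe_part n True" using f root_space_plus_odd by metis
  obtain d where d: "x \<in> pe_part n d"
    using root_space_homogeneous \<alpha>(1) x borel_roots_subset_roots by blast
  obtain \<beta> where "\<beta> \<in> borel_roots n p - {wt_neg (gamma_seq n ! p)}" "sbracket n x f \<in> root_space n \<beta>"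
    using borel_roots_bracket_gamma[OF p \<alpha> x f] by blast
  then have "i + m \<le> l \<Longrightarrow> act (tens n (sbracket n x f) (i + m)) z = 0"
    using z by blast
  moreover have "act (tens n x i) z = 0" using z \<alpha> x i by blast
  moreover have "tens n f m \<in> takiff n l (pe n)" using f m root_space_subset_pe by (intro tens_pe)
  ultimately show ?thesis
    using act_tens_commute[OF d fodd i m, of z] by (simp add: act_zero_vector)
qed

lemma act_tens_cartan:
  assumes H: "\<forall>h\<in>takiff n l (cartan n). act h v = scale (lam h) v" and "h \<in> cartan n" "i \<le> l"
  shows "act (tens n h i) v = scale (lam (tens n h i)) v"
  using assms by (simp add: tens_in_takiff cartan_zero)

text \<open>Downward induction on \<open>m\<close>: knowing that \<open>f\<close> in degrees above \<open>m\<close> kills \<open>v\<close>, the Cartan part acts on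
  \<open>u = f\<^sup>(\<^sup>m\<^sup>) v\<close> by scalars. The assumption \<open>bracket\<close> makes \<open>u\<close> killed by the root \<open>-\<gamma>\<close> as well, if it is a root
  of the Borel subalgebra. Then \<open>v\<close> has a higher weight than \<open>u\<close> for the separating functional,
  which forces \<open>u = 0\<close>.\<close>

lemma raising_vanishes:
  assumes simple: "simple_module scale n l V act"
    and p: "p < length (gamma_seq n)" and f: "f \<in> root_space n (gamma_seq n ! p)"
    and v: "highest_weight_vector scale n l act (chain_borel n p) lam v"
    and bracket: "\<And>e m. wt_neg (gamma_seq n ! p) \<in> borel_roots n p \<Longrightarrow>
      e \<in> root_space n (wt_neg (gamma_seq n ! p)) \<Longrightarrow> k \<le> m \<Longrightarrow> m \<le> l \<Longrightarrow>
      act (tens n (sbracket n e f) m) v = 0"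
    and m: "k \<le> m" "m \<le> l"
  shows "act (tens n f m) v = 0"
  using m
proof (induction "l - m" arbitrary: m rule: less_induct)
  case less
  let ?\<gamma> = "gamma_seq n ! p"
  let ?u = "act (tens n f m) v"
  obtain a b where ab: "a \<le> b" "b < n" "?\<gamma> = wt_add (eps a) (eps b)"
    using gamma_seq_nth[OF p] by metis
  have fodd: "f \<in> pe_part n True" using f root_space_plus_odd[OF _ ab(1,2)] ab(3) by simp
  have fpe: "tens n f m \<in> takiff n l (pe n)" using f less.prems root_space_subset_pe by (intro tens_pe)
  have later: "act (tens n f m') v = 0" if "m < m'" "m' \<le> l" for m'
    using less.hyps[of m'] less.prems that by simp
  have killed: "\<forall>\<alpha>\<in>borel_roots n p. \<forall>x\<in>root_space n \<alpha>. \<forall>i\<le>l. act (tens n x i) v = 0"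
    using v by (rule highest_weight_vector_killed)
  have H: "\<forall>h\<in>takiff n l (cartan n). act h v = scale (lam h) v" and "v \<noteq> 0"
    using v by (simp_all add: highest_weight_vector_def)
  obtain D t where D: "D \<in> cartan n"
    and low: "\<And>\<alpha>. \<alpha> \<in> roots n \<Longrightarrow> \<alpha> \<notin> borel_roots n p \<Longrightarrow> \<exists>t\<le>0. \<alpha> D = complex_of_real t"
    and t: "t < 0" "?\<gamma> D = complex_of_real t"
    using separating_functional[OF p] by metis
  have cartan: "act (tens n h i) ?u = scale (lam (tens n h i) + ?\<gamma> (tens n h i 0)) ?u"
    if "h \<in> cartan n" "i \<le> l" for h i
  proof -
    have h: "tens n h i \<in> takiff n l (cartan n)" using that by (intro tens_in_takiff cartan_zero)
    show ?thesis
      using act_cartan_commute[OF h f fodd less.prems(2) later] H h fpe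
      by (simp add: act_scale scale_left_distrib)
  qed
  show ?case
  proof (rule no_higher_weight[OF simple D, of "roots n - borel_roots n p" _ _ v "- t"])
    show "\<forall>\<alpha>\<in>roots n - (roots n - borel_roots n p). \<forall>x\<in>root_space n \<alpha>. \<forall>i\<le>l. act (tens n x i) ?u = 0"
    proof (intro ballI allI impI)
      fix \<alpha> x i assume "\<alpha> \<in> roots n - (roots n - borel_roots n p)" and x: "x \<in> root_space n \<alpha>" and i: "i \<le> l"
      then have \<alpha>: "\<alpha> \<in> borel_roots n p" by blast
      show "act (tens n x i) ?u = 0"
      proof (cases "\<alpha> = wt_neg ?\<gamma>")
        case False
        then show ?thesis using raising_preserves_killed[OF p f less.prems(2) _ \<alpha> _ x i] killed by blast
      next
        case True
        obtain d where d: "x \<in> pe_part n d"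
          using root_space_homogeneous \<alpha> x borel_roots_subset_roots by blast
        have "i + m \<le> l \<Longrightarrow> act (tens n (sbracket n x f) (i + m)) v = 0"
          using bracket \<alpha> x True less.prems(1) by simp
        moreover have "act (tens n x i) v = 0" using killed \<alpha> x i by blast
        ultimately show ?thesis
          using act_tens_commute[OF d fodd i less.prems(2), of v] fpe by (simp add: act_zero_vector)
      qed
    qed
    show "\<forall>h\<in>cartan n. \<forall>i\<le>l. \<exists>c. act (tens n h i) ?u = scale c ?u"
      using cartan by blast
    show "act (tens n D 0) ?u = scale (lam (tens n D 0) + complex_of_real t) ?u"
      using cartan[OF D] t(2) by (simp add: tens_def)
    show "act (tens n D 0) v = scale (complex_of_real (- t) + (lam (tens n D 0) + complex_of_real t)) v"
      using act_tens_cartan[OF H D] by simp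
  qed (use low t \<open>v \<noteq> 0\<close> in auto)
qed

lemma highest_weight_vector_Suc:
  assumes p: "p < length (gamma_seq n)"
    and v: "highest_weight_vector scale n l act (chain_borel n p) lam v"
    and vanish: "\<And>f m. f \<in> root_space n (gamma_seq n ! p) \<Longrightarrow> m \<le> l \<Longrightarrow> act (tens n f m) v = 0"
  shows "highest_weight_vector scale n l act (chain_borel n (Suc p)) lam v"
proof (rule highest_weight_vectorI)
  show "\<forall>\<alpha>\<in>borel_roots n (Suc p). \<forall>x\<in>root_space n \<alpha>. \<forall>i\<le>l. act (tens n x i) v = 0"
    using vanish highest_weight_vector_killed[OF v] borel_roots_Suc[OF p] by blast
qed (use v in \<open>auto simp: highest_weight_vector_def\<close>)

text \<open>The shift by a multiple of \<open>\<gamma>\<close> does not change the result, because \<open>\<gamma> = \<epsilon>\<^sub>i + \<epsilon>\<^sub>j\<close> vanishes on the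
  Cartan element \<open>[e, f]\<close>, which is a multiple of the one dual to \<open>\<epsilon>\<^sub>i - \<epsilon>\<^sub>j\<close>.\<close>

lemma act_opposite_bracket:
  assumes ij: "i < j" "j < n"
    and e: "e \<in> root_space n (wt_neg (wt_add (eps i) (eps j)))"
    and f: "f \<in> root_space n (wt_add (eps i) (eps j))"
    and H: "\<forall>h\<in>takiff n l (cartan n). act h z = scale (lam h + c * wt_add (eps i) (eps j) (h 0)) z"
    and m: "m \<le> l"
  shows "act (tens n (sbracket n e f) m) z =
    scale (- (e $$ (n + i, j) * f $$ (i, n + j)) * wt_form n (wt_component n lam m) (wt_diff (eps i) (eps j))) z"
proof -
  have i: "i < n" "i \<le> j" using ij by auto
  let ?b = "e $$ (n + i, j) * f $$ (i, n + j)"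
  let ?H = "cartan_basis n j + (- 1) \<cdot>\<^sub>m cartan_basis n i"
  have cb: "cartan_basis n i \<in> cartan n" "cartan_basis n j \<in> cartan n"
    using i ij by (simp_all add: cartan_basis_in_cartan)
  note cb_pe = cb[THEN cartan_subset_pe]
  have "sbracket n e f = ?b \<cdot>\<^sub>m sbracket n (minus_vector n i j) (plus_vector n i j)"
    by (subst root_space_minus_eq[OF e ij], subst root_space_plus_eq[OF f i(2) ij(2)], rule eq_matI)
      (auto simp: sbracket_index minus_vector_def plus_vector_def sum_distrib_left algebra_simps intro!: sum.cong)
  then have "sbracket n e f = ?b \<cdot>\<^sub>m ?H" by (simp add: sbracket_minus_plus[OF ij])
  then have "act (tens n (sbracket n e f) m) z =
      scale ?b (act (tens n (cartan_basis n j) m) z + scale (- 1) (act (tens n (cartan_basis n i) m) z))"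
    using cb_pe m by (simp add: act_tens_smult act_tens_add pe_add pe_smult)
  moreover have "act (tens n (cartan_basis n a) m) z =
      scale (lam (tens n (cartan_basis n a) m) + (if m = 0 then c else 0)) z" if "a = i \<or> a = j" for a
  proof -
    have "tens n (cartan_basis n a) m \<in> takiff n l (cartan n)"
      using cb that m by (auto intro!: tens_in_takiff cartan_zero)
    moreover have "wt_add (eps i) (eps j) (tens n (cartan_basis n a) m 0) = (if m = 0 then 1 else 0)"
      using that i ij by (auto simp: tens_def wt_add_def eps_cartan_basis) (auto simp: eps_def)
    ultimately show ?thesis using H by simp
  qed
  ultimately show ?thesis
    using i ij by (simp add: wt_form_diff scale_left_diff_distrib scale_right_diff_distrib scale_left_distrib algebra_simps)
qed

text \<open>With \<open>w r = f\<^sup>(\<^sup>r\<^sup>) \<dots> f\<^sup>(\<^sup>k\<^sup>) v\<close>, all required properties are carried along from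
  \<open>w (k + 1) = v\<close> down to \<open>w 0\<close>. Nonvanishing comes from \<open>e\<^sup>(\<^sup>k\<^sup>-\<^sup>r\<^sup>) w r\<close>, which is a nonzero
  multiple of \<open>w (r + 1)\<close>: the pairing with index \<open>k\<close> appears in \<open>[e, f]\<^sup>(\<^sup>k\<^sup>)\<close>, and
  \<open>e\<^sup>(\<^sup>k\<^sup>-\<^sup>r\<^sup>)\<close> itself kills \<open>w (r + 1)\<close>.\<close>

lemma odd_reflection:
  assumes simple: "simple_module scale n l V act"
    and p: "p < length (gamma_seq n)" and \<gamma>: "gamma_seq n ! p = wt_add (eps i) (eps j)" and ij: "i < j" "j < n"
    and v: "highest_weight_vector scale n l act (chain_borel n p) lam v"
    and f: "f \<in> root_space n (gamma_seq n ! p)" "f \<noteq> 0\<^sub>m (n + n) (n + n)"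
    and k: "k \<le> l" "wt_form n (wt_component n lam k) (wt_diff (eps i) (eps j)) \<noteq> 0"
    and above: "\<And>m. k < m \<Longrightarrow> m \<le> l \<Longrightarrow> wt_form n (wt_component n lam m) (wt_diff (eps i) (eps j)) = 0"
  shows "highest_weight_vector scale n l act (chain_borel n (Suc p))
    (\<lambda>h. lam h + of_nat (Suc k) * wt_add (eps i) (eps j) (h 0))
    (foldr (\<lambda>m w. act (tens n f m) w) [0..<Suc k] v)"
proof -
  let ?\<gamma> = "wt_add (eps i) (eps j)" and ?f = "\<lambda>m. act (tens n f m)" and ?e = "minus_vector n i j"
  let ?c = "\<lambda>m. wt_form n (wt_component n lam m) (wt_diff (eps i) (eps j))"
  define w where "w r = foldr ?f [r..<Suc k] v" for r
  have i: "i < n" "i \<le> j" using ij by auto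
  have ind: "gamma_indices n ! p = (i, j)" using gamma_seq_nth_indices[OF p \<gamma>] ij by simp
  have f': "f \<in> root_space n ?\<gamma>" using f \<gamma> by simp
  have fodd: "f \<in> pe_part n True" using root_space_plus_odd[OF f' i(2) ij(2)] .
  have f_pe: "tens n f m \<in> takiff n l (pe n)" if "m \<le> l" for m
    using f root_space_subset_pe that by (intro tens_pe)
  have f_entry: "f $$ (i, n + j) \<noteq> 0"
  proof
    assume "f $$ (i, n + j) = 0"
    then have "f = 0 \<cdot>\<^sub>m plus_vector n i j" using root_space_plus_eq[OF f' i(2) ij(2)] by simp
    then have "f = 0\<^sub>m (n + n) (n + n)" by (auto simp: plus_vector_def mat_eq_iff)
    then show False using f by simp
  qed
  have e: "?e \<in> root_space n (wt_neg ?\<gamma>)" by (rule minus_vector_root[OF ij])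
  have eodd: "?e \<in> pe_part n True" using root_space_minus_odd[OF e ij] .
  have e_entry: "?e $$ (n + i, j) = 1" using ij by (simp add: minus_vector_def)
  have e_root: "wt_neg ?\<gamma> \<in> borel_roots n p"
    using chain_odd_roots_minusI[OF p ind ij] by (simp add: borel_roots_def index_before_def)
  have killed: "\<forall>\<alpha>\<in>borel_roots n p. \<forall>x\<in>root_space n \<alpha>. \<forall>i\<le>l. act (tens n x i) v = 0"
    using v by (rule highest_weight_vector_killed)
  have H: "\<forall>h\<in>takiff n l (cartan n). act h v = scale (lam h) v" and v0: "v \<noteq> 0"
    and lam: "lam \<in> takiff_dual n l"
    using v by (simp_all add: highest_weight_vector_def)
  have vanish: "?f m v = 0" if "k < m" "m \<le> l" for m
  proof (rule raising_vanishes[OF simple p f(1) v, of "Suc k"])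
    fix e' m' assume e': "e' \<in> root_space n (wt_neg (gamma_seq n ! p))" and m': "Suc k \<le> m'" "m' \<le> l"
    show "act (tens n (sbracket n e' f) m') v = 0"
      using act_opposite_bracket[OF ij e'[unfolded \<gamma>] f' _ m'(2), of v lam 0] H above[of m'] m' by simp
  qed (use that in auto)
  have w_top: "w (Suc k) = v" by (simp add: w_def)
  have w_step: "w r = ?f r (w (Suc r))" if "r \<le> k" for r
    using that by (simp add: w_def upt_conv_Cons del: upt_Suc)
  have anti: "?f m (?f r z) = - ?f r (?f m z)" if "m \<le> l" "r \<le> l" for m r z
  proof -
    have "sbracket n f f = 0\<^sub>m (n + n) (n + n)"
      by (rule sbracket_plus_plus[OF f' i(2) ij(2) f' i(2) ij(2)])
    then show ?thesis using act_tens_commute[OF fodd fodd that, of z] by (simp add: act_tens_zero)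
  qed
  define reflected where "reflected r \<longleftrightarrow>
      (\<forall>m. r \<le> m \<and> m \<le> l \<longrightarrow> ?f m (w r) = 0) \<and>
      (\<forall>h\<in>takiff n l (cartan n). act h (w r) = scale (lam h + of_nat (Suc k - r) * ?\<gamma> (h 0)) (w r)) \<and>
      (\<forall>a\<le>l. k < a + r \<longrightarrow> act (tens n ?e a) (w r) = 0) \<and>
      (\<forall>\<beta>\<in>borel_roots n p - {wt_neg (gamma_seq n ! p)}. \<forall>x\<in>root_space n \<beta>. \<forall>i\<le>l. act (tens n x i) (w r) = 0) \<and>
      w r \<noteq> 0" for r
  have "reflected 0"
  proof (rule inc_induct[of 0 "Suc k" reflected])
    show "reflected (Suc k)"
      unfolding reflected_def w_top using vanish H killed e_root e v0 by (auto simp: Suc_le_eq)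
  next
    fix r assume "r < Suc k" and IH: "reflected (Suc r)"
    then have r: "r \<le> k" "r \<le> l" using k by auto
    let ?z = "w (Suc r)"
    have z_raise: "?f m ?z = 0" if "r < m" "m \<le> l" for m
      using IH that by (simp add: reflected_def)
    have z_cartan: "act h ?z = scale (lam h + of_nat (k - r) * ?\<gamma> (h 0)) ?z" if "h \<in> takiff n l (cartan n)" for h
      using IH that by (simp add: reflected_def)
    have z_lower: "act (tens n ?e a) ?z = 0" if "a \<le> l" "k \<le> a + r" for a
      using IH that by (simp add: reflected_def)
    have z: "?z \<noteq> 0" using IH by (simp add: reflected_def)
    \<comment> \<open>Commuting \<open>e\<close> past the leftmost \<open>f\<close> leaves only the Cartan term, since \<open>e\<close> in this degree kills \<open>w (r + 1)\<close>.\<close>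
    have lower: "act (tens n ?e a) (w r) = (if a + r \<le> l then scale (- (f $$ (i, n + j)) * ?c (a + r)) ?z else 0)"
      if "a \<le> l" "k \<le> a + r" for a
    proof -
      have "act (tens n (sbracket n ?e f) (a + r)) ?z = scale (- (f $$ (i, n + j)) * ?c (a + r)) ?z" if "a + r \<le> l"
        using act_opposite_bracket[OF ij e f' _ that, of ?z lam "of_nat (k - r)"] z_cartan e_entry by simp
      then show ?thesis
        using act_tens_commute[OF eodd fodd that(1) r(2), of ?z] z_lower[OF that] f_pe[OF r(2)]
        by (simp add: w_step[OF r(1)] act_zero_vector)
    qed
    show "reflected r"
      unfolding reflected_def
    proof (intro conjI allI ballI impI)
      fix m assume m: "r \<le> m \<and> m \<le> l"
      show "?f m (w r) = 0"
      proof (cases "m = r")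
        case True
        have "?f r (w r) = - ?f r (w r)" using anti[OF r(2) r(2), of ?z] w_step[OF r(1)] by simp
        then have "scale 2 (?f r (w r)) = 0"
          using scale_left_distrib[of 1 1 "?f r (w r)"] by (simp add: eq_neg_iff_add_eq_0)
        then show ?thesis using True by simp
      next
        case False
        then show ?thesis using anti[of m r ?z] m r z_raise[of m] f_pe[OF r(2)]
          by (simp add: w_step[OF r(1)] act_zero_vector)
      qed
    next
      fix h assume h: "h \<in> takiff n l (cartan n)"
      have "act h (w r) = ?f r (act h ?z) + scale (?\<gamma> (h 0)) (w r)"
        using act_cartan_commute[OF h f' fodd r(2) z_raise] w_step[OF r(1)] by simp
      also have "\<dots> = scale (lam h + of_nat (k - r) * ?\<gamma> (h 0) + ?\<gamma> (h 0)) (w r)"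
        using f_pe[OF r(2)] by (simp add: z_cartan[OF h] act_add act_scale w_step[OF r(1)] scale_left_distrib)
      finally show "act h (w r) = scale (lam h + of_nat (Suc k - r) * ?\<gamma> (h 0)) (w r)"
        using r by (simp add: Suc_diff_le algebra_simps)
    next
      fix a assume "a \<le> l" "k < a + r"
      then show "act (tens n ?e a) (w r) = 0"
        using lower[of a] above[of "a + r"] by simp
    next
      fix \<beta> x i assume "\<beta> \<in> borel_roots n p - {wt_neg (gamma_seq n ! p)}" "x \<in> root_space n \<beta>" "i \<le> l"
      then show "act (tens n x i) (w r) = 0"
        using raising_preserves_killed[OF p f(1) r(2), of ?z \<beta> x i] IH
        by (simp add: reflected_def w_step[OF r(1)])
    next
      have kr: "k - r \<le> l" "k - r + r = k" using r k by auto
      have "act (tens n ?e (k - r)) (w r) = scale (- (f $$ (i, n + j)) * ?c k) ?z"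
        using lower[of "k - r"] kr k(1) by simp
      then have "act (tens n ?e (k - r)) (w r) \<noteq> 0"
        using z f_entry k(2) by simp
      then show "w r \<noteq> 0"
        using act_zero_vector[OF tens_pe[OF root_space_subset_pe[OF e] kr(1)]] by auto
    qed
  qed simp
  then have w: "\<forall>m\<le>l. ?f m (w 0) = 0"
      "\<forall>h\<in>takiff n l (cartan n). act h (w 0) = scale (lam h + of_nat (Suc k) * ?\<gamma> (h 0)) (w 0)"
      "\<forall>\<beta>\<in>borel_roots n p - {wt_neg (gamma_seq n ! p)}. \<forall>x\<in>root_space n \<beta>. \<forall>i\<le>l. act (tens n x i) (w 0) = 0"
      "w 0 \<noteq> 0"
    by (simp_all add: reflected_def del: of_nat_Suc)
  have "highest_weight_vector scale n l act (chain_borel n (Suc p))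
      (\<lambda>h. lam h + of_nat (Suc k) * ?\<gamma> (h 0)) (w 0)"
  proof (rule highest_weight_vectorI[OF _ w(4) _ w(2)])
    have carr: "h 0 \<in> carrier_mat (n + n) (n + n)" if "h \<in> takiff n l (cartan n)" for h
      using that cartan_subset_pe pe_carrier by (auto simp: takiff_def)
    show "(\<lambda>h. lam h + of_nat (Suc k) * ?\<gamma> (h 0)) \<in> takiff_dual n l"
      using lam i ij unfolding takiff_dual_def
      by (auto simp: tadd_def tsmult_def wt_add_def eps_def algebra_simps dest!: carr)
    show "\<forall>\<alpha>\<in>borel_roots n (Suc p). \<forall>x\<in>root_space n \<alpha>. \<forall>i\<le>l. act (tens n x i) (w 0) = 0"
    proof (intro ballI allI impI)
      fix \<alpha> x m assume \<alpha>: "\<alpha> \<in> borel_roots n (Suc p)" and x: "x \<in> root_space n \<alpha>" and m: "m \<le> l"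
      show "act (tens n x m) (w 0) = 0"
      proof (cases "\<alpha> = gamma_seq n ! p")
        case False
        then show ?thesis using borel_roots_Suc[OF p \<alpha>] w(3) x m by blast
      next
        case True
        then have x': "x \<in> root_space n ?\<gamma>" using x \<gamma> by simp
        \<comment> \<open>Root spaces of \<open>\<gamma>\<close> are one-dimensional, so \<open>x\<close> is a multiple of \<open>f\<close>.\<close>
        define q where "q = x $$ (i, n + j) / f $$ (i, n + j)"
        have "q \<cdot>\<^sub>m f = (q * f $$ (i, n + j)) \<cdot>\<^sub>m plus_vector n i j"
          by (subst root_space_plus_eq[OF f' i(2) ij(2)]) (rule eq_matI, auto)
        also have "\<dots> = x"
          using f_entry root_space_plus_eq[OF x' i(2) ij(2)] by (simp add: q_def)
        finally have "x = q \<cdot>\<^sub>m f" ..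
        then show ?thesis using w(1) m root_space_subset_pe[OF f'] by (simp add: act_tens_smult)
      qed
    qed
  qed
  then show ?thesis by (simp only: w_def)
qed

end

theorem proposition12:
  fixes scale :: "complex \<Rightarrow> 'v::ab_group_add \<Rightarrow> 'v"
    and n l p :: nat
    and V :: "bool \<Rightarrow> 'v set"
    and act :: "tmat \<Rightarrow> 'v \<Rightarrow> 'v"
    and lam :: "tmat \<Rightarrow> complex"
    and v :: 'v
  assumes "l \<ge> 1"
    and "takiff_pe_module scale n l V act"
    and "in_category_O scale n l act"
    and "simple_module scale n l V act"
    and "p < length (gamma_seq n)"
    and "highest_weight_vector scale n l act (chain_borel n p) lam v"
  shows "(\<forall>i j f. i < j \<and> j < n \<and> gamma_seq n ! p = wt_add (eps i) (eps j) \<and>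
            f \<in> root_space n (gamma_seq n ! p) \<and> f \<noteq> 0\<^sub>m (n + n) (n + n) \<longrightarrow>
            (\<forall>k\<le>l. wt_form n (wt_component n lam k) (wt_diff (eps i) (eps j)) \<noteq> 0 \<and>
               (\<forall>m. k < m \<and> m \<le> l \<longrightarrow>
                  wt_form n (wt_component n lam m) (wt_diff (eps i) (eps j)) = 0) \<longrightarrow>
               (\<exists>mu. highest_weight_vector scale n l act (chain_borel n (Suc p)) mu
                  (foldr (\<lambda>m w. act (tens n f m) w) [0..<Suc k] v))) \<and>
            ((\<forall>k\<le>l. wt_form n (wt_component n lam k) (wt_diff (eps i) (eps j)) = 0) \<longrightarrow>
               (\<exists>mu. highest_weight_vector scale n l act (chain_borel n (Suc p)) mu v)))
       \<and> (connected_by_inclusion n (chain_borel n p) (chain_borel n (Suc p)) \<longrightarrow>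
            (\<exists>mu. highest_weight_vector scale n l act (chain_borel n (Suc p)) mu v))"
proof -
  interpret takiff_pe_module scale n l V act by fact
  note simple = assms(4) and p = assms(5) and v = assms(6)
  have H: "\<forall>h\<in>takiff n l (cartan n). act h v = scale (lam h) v"
    using v by (simp add: highest_weight_vector_def)
  have reflect: "highest_weight_vector scale n l act (chain_borel n (Suc p)) lam v"
    if ij: "i < j" "j < n" and \<gamma>: "gamma_seq n ! p = wt_add (eps i) (eps j)"
      and zero: "\<forall>k\<le>l. wt_form n (wt_component n lam k) (wt_diff (eps i) (eps j)) = 0" for i j
  proof (rule highest_weight_vector_Suc[OF p v])
    fix f m assume f: "f \<in> root_space n (gamma_seq n ! p)" and m: "m \<le> l"
    show "act (tens n f m) v = 0"
    proof (rule raising_vanishes[OF simple p f v, of 0])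
      fix e m assume e: "e \<in> root_space n (wt_neg (gamma_seq n ! p))" and m: "m \<le> l"
      show "act (tens n (sbracket n e f) m) v = 0"
        using act_opposite_bracket[OF ij e[unfolded \<gamma>] f[unfolded \<gamma>] _ m, of v lam 0] H zero m by simp
    qed (use m in auto)
  qed
  have incl: "highest_weight_vector scale n l act (chain_borel n (Suc p)) lam v"
    if "connected_by_inclusion n (chain_borel n p) (chain_borel n (Suc p))"
  proof (rule highest_weight_vector_Suc[OF p v])
    obtain i j where ij: "i \<le> j" "j < n" "gamma_indices n ! p = (i, j)" "gamma_seq n ! p = wt_add (eps i) (eps j)"
      using gamma_seq_nth[OF p] .
    then have "i = j" using not_connected_by_inclusion[OF p ij(4)] that by fastforce
    have no_opposite: "wt_neg (gamma_seq n ! p) \<notin> borel_roots n p"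
    proof
      assume "wt_neg (gamma_seq n ! p) \<in> borel_roots n p"
      then show False using p ij(3)
      proof (cases rule: borel_roots_cases)
        case (even a b)
        then show False using root_kinds_distinct(2)[of a n b i j] ij by simp
      next
        case (plus a b)
        then show False using root_kinds_distinct(3)[of a n b i j] ij by simp
      next
        case (minus a b)
        then have eq: "wt_add (eps i) (eps j) = wt_add (eps a) (eps b)"
          using ij(4) by (simp add: wt_neg_inject)
        have "i = a \<and> j = b"
          using wt_add_eps_inject[OF fun_cong[OF eq] ij(1,2)] minus(1,2) by simp
        then show False using \<open>i = j\<close> minus(1) by simp
      qed
    qed
    fix f m assume "f \<in> root_space n (gamma_seq n ! p)" "m \<le> l"
    then show "act (tens n f m) v = 0"
      using raising_vanishes[OF simple p _ v, of f 0 m] no_opposite by blast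
  qed
  show ?thesis
    using odd_reflection[OF simple p _ _ _ v] reflect incl by blast
qed

end
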